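(* Let $\varphi$ be a white noise random dynamical system on a complete separable metric space $(E,d)$, and assume that $\varphi$ is swift transitive. Then: (1) Assume that $\varphi$ is contracting on large sets. Then every $\mathcal F_0$-measurable, $\varphi$-invariant random compact set $A$ has small diameter. (2) Assume that $\varphi$ is asymptotically stable on some non-empty open set $U\subset E$. Let $A$ be an $\mathcal F_0$-measurable, $\varphi$-invariant random closed set with small diameter. Then $A$ is a singleton $\mathbb P$-a.s. In particular, if there is a weak attractor $A$ with small diameter, then synchronization occurs.
   Context: $(E,d)$ is a complete separable metric space; $B(x,r)$ is the open ball of radius $r$ around $x$, and $\mathrm{diam}(A)=\sup_{a,b\in A}d(a,b)$. $(\Omega,\mathcal F,\mathbb P,\theta)$ is an ergodic metric dynamical system: $(\Omega,\mathcal F,\mathbb P)$ is a (not necessarily complete) probability space and $\theta=(\theta_t)_{t\in\mathbb R}$ is a group of jointly measurable maps on $\Omega$ with ergodic invariant measure $\mathbb P$. A random dynamical system (RDS) is a measurable map $\varphi:\mathbb R_+\times\Omega\times E\to E$ with $\varphi_0(\omega,x)=x$, $\varphi_{t+s}(\omega,x)=\varphi_t(\theta_s\omega,\varphi_s(\omega,x))$ for all $s,t\ge0$, $x\in E$, $\omega\in\Omega$, and $x\mapsto\varphi_s(\omega,x)$ continuous for all $s,\omega$. It is a white noise RDS if there is a family $(\mathcal F_{s,t})_{-\infty<s\le t<\infty}$ of sub-$\sigma$-algebras of $\mathcal F$ with $\mathcal F_{t,u}\subseteq\mathcal F_{s,v}$ and $\mathcal F_{s,t},\mathcal F_{u,v}$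 independent whenever $s\le t\le u\le v$, $\theta_r^{-1}(\mathcal F_{s,t})=\mathcal F_{s+r,t+r}$ for all $r$ and $s\le t$, and $\varphi_s(\cdot,x)$ is $\mathcal F_{0,s}$-measurable for all $s\ge0$, $x\in E$. $\mathcal F_0$ is the smallest $\sigma$-algebra containing all $\mathcal F_{s,0}$, $s\le0$. A random closed (compact) set is a family $A=\{A(\omega)\}_{\omega\in\Omega}$ of non-empty subsets of $E$ that is $\mathbb P$-a.s. closed (compact) and such that $\omega\mapsto d(x,A(\omega))$ is $\mathcal F$-measurable for each $x\in E$; it is $\mathcal F_0$-measurable if these maps are $\mathcal F_0$-measurable. $A$ is $\varphi$-invariant if for all $t\ge0$, $\varphi_t(\omega,A(\omega))=A(\theta_t\omega)$ for almost all $\omega$. Swift transitive: for every ball $B(x,r)$ and every $y\in E$ there is $t>0$ with $\mathbb P(\varphi_t(\cdot,B(x,r))\subset B(y,2r))>0$. Contracting on large sets: for every $R>0$ there are a ball $B(y,R)$ and a time $t>0$ with $\mathbb P(\mathrm{diam}(\varphi_t(\cdot,B(y,R)))\le R/4)>0$. Asymptotically stable on a (deterministic) non-empty open set $U$: there is a deterministic sequence $t_n\uparrow\infty$ with $\mathbb P(\lim_{n\to\infty}\mathrm{diam}(\varphi_{t_n}(\cdot,U))=0)>0$. A random closed set $A$ has small diameter if $\mathrm{ess\,inf}_{\omega\in\Omega}\,\mathrm{diam}(A(\omega))=0$, i.e. $\mathbb P(\mathrm{diam}(A)<\varepsilon)>0$ for every $\varepsilon>0$. A weak attractor is a $\varphi$-invariant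 random compact set $A$ such that for every compact $B\subseteq E$, $\sup_{x\in B}d(\varphi_t(\theta_{-t}\omega,x),A(\omega))\to0$ in probability as $t\to\infty$. Synchronization occurs if there is a weak attractor $A(\omega)$ that is a singleton for $\mathbb P$-a.e. $\omega$. *)

theory Defs
  imports "HOL-Probability.Probability"
begin

text \<open>The complete separable metric space \<open>E\<close> is a type of class \<open>polish_space\<close>; the sample
  space \<open>\<Omega>\<close> is \<open>space M\<close>. Maps are only constrained for sample points in \<open>space M\<close> and,
  in the case of \<open>\<phi>\<close>, for times \<open>t \<ge> 0\<close>.\<close>

section \<open>Random dynamical systems\<close>

locale ergodic_metric_ds = prob_space M
  for M :: "'w measure" +
  fixes \<theta> :: "real \<Rightarrow> 'w \<Rightarrow> 'w"
  assumes theta_measurable: "(\<lambda>(t, \<omega>). \<theta> t \<omega>) \<in> measurable (borel \<Otimes>\<^sub>M M) M"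
    and theta_zero: "\<omega> \<in> space M \<Longrightarrow> \<theta> 0 \<omega> = \<omega>"
    and theta_add: "\<omega> \<in> space M \<Longrightarrow> \<theta> (s + t) \<omega> = \<theta> s (\<theta> t \<omega>)"
    and theta_invariant: "distr M M (\<theta> t) = M"
    and theta_ergodic:
      "\<lbrakk>X \<in> sets M; \<And>t. \<theta> t -` X \<inter> space M = X\<rbrakk> \<Longrightarrow> prob X = 0 \<or> prob X = 1"

locale rds = ergodic_metric_ds M \<theta>
  for M :: "'w measure" and \<theta> :: "real \<Rightarrow> 'w \<Rightarrow> 'w" +
  fixes \<phi> :: "real \<Rightarrow> 'w \<Rightarrow> 'e::polish_space \<Rightarrow> 'e"
  assumes phi_measurable:
      "(\<lambda>(t, \<omega>, x). \<phi> t \<omega> x)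
         \<in> measurable (restrict_space borel {0..} \<Otimes>\<^sub>M M \<Otimes>\<^sub>M borel) borel"
    and phi_zero: "\<omega> \<in> space M \<Longrightarrow> \<phi> 0 \<omega> x = x"
    and phi_cocycle:
      "\<lbrakk>\<omega> \<in> space M; 0 \<le> s; 0 \<le> t\<rbrakk> \<Longrightarrow> \<phi> (t + s) \<omega> x = \<phi> t (\<theta> s \<omega>) (\<phi> s \<omega> x)"
    and phi_continuous: "\<lbrakk>\<omega> \<in> space M; 0 \<le> s\<rbrakk> \<Longrightarrow> continuous_on UNIV (\<phi> s \<omega>)"

locale white_noise_rds = rds M \<theta> \<phi>
  for M :: "'w measure" and \<theta> :: "real \<Rightarrow> 'w \<Rightarrow> 'w"
    and \<phi> :: "real \<Rightarrow> 'w \<Rightarrow> 'e::polish_space \<Rightarrow> 'e" +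
  fixes \<F> :: "real \<Rightarrow> real \<Rightarrow> 'w measure"
  assumes F_subalgebra: "s \<le> t \<Longrightarrow> subalgebra M (\<F> s t)"
    and F_mono: "\<lbrakk>s \<le> t; t \<le> u; u \<le> v\<rbrakk> \<Longrightarrow> sets (\<F> t u) \<subseteq> sets (\<F> s v)"
    and F_indep: "\<lbrakk>s \<le> t; t \<le> u; u \<le> v\<rbrakk> \<Longrightarrow> indep_set (sets (\<F> s t)) (sets (\<F> u v))"
    and F_shift: "s \<le> t \<Longrightarrow>
      (\<lambda>X. \<theta> r -` X \<inter> space M) ` sets (\<F> s t) = sets (\<F> (s + r) (t + r))"
    and phi_adapted: "0 \<le> s \<Longrightarrow> (\<lambda>\<omega>. \<phi> s \<omega> x) \<in> measurable (\<F> 0 s) borel"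

definition past_algebra :: "'w measure \<Rightarrow> (real \<Rightarrow> real \<Rightarrow> 'w measure) \<Rightarrow> 'w measure" where
  "past_algebra M \<F> = sigma (space M) (\<Union>s\<in>{..0}. sets (\<F> s 0))"

section \<open>Diameter\<close>

text \<open>The library's \<open>diameter\<close> is real-valued and hence meaningless on unbounded sets;
  here the diameter takes values in \<open>[0, \<infinity>]\<close>.\<close>

definition ediam :: "'e::metric_space set \<Rightarrow> ennreal" where
  "ediam A = (SUP a\<in>A. SUP b\<in>A. ennreal (dist a b))"

section \<open>Random sets\<close>

definition random_closed_set :: "'w measure \<Rightarrow> ('w \<Rightarrow> 'e::metric_space set) \<Rightarrow> bool" where
  "random_closed_set M A \<longleftrightarrow>
     (\<forall>\<omega>\<in>space M. A \<omega> \<noteq> {}) \<and> (AE \<omega> in M. closed (A \<omega>)) \<and>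
     (\<forall>x. (\<lambda>\<omega>. infdist x (A \<omega>)) \<in> borel_measurable M)"

definition random_compact_set :: "'w measure \<Rightarrow> ('w \<Rightarrow> 'e::metric_space set) \<Rightarrow> bool" where
  "random_compact_set M A \<longleftrightarrow>
     (\<forall>\<omega>\<in>space M. A \<omega> \<noteq> {}) \<and> (AE \<omega> in M. compact (A \<omega>)) \<and>
     (\<forall>x. (\<lambda>\<omega>. infdist x (A \<omega>)) \<in> borel_measurable M)"

definition set_measurable_wrt :: "'w measure \<Rightarrow> ('w \<Rightarrow> 'e::metric_space set) \<Rightarrow> bool" where
  "set_measurable_wrt G A \<longleftrightarrow> (\<forall>x. (\<lambda>\<omega>. infdist x (A \<omega>)) \<in> borel_measurable G)"

definition phi_invariant ::
  "'w measure \<Rightarrow> (real \<Rightarrow> 'w \<Rightarrow> 'w) \<Rightarrow> (real \<Rightarrow> 'w \<Rightarrow> 'e \<Rightarrow> 'e) \<Rightarrow> ('w \<Rightarrow> 'e set) \<Rightarrow> bool"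
where
  "phi_invariant M \<theta> \<phi> A \<longleftrightarrow> (\<forall>t\<ge>0. AE \<omega> in M. \<phi> t \<omega> ` A \<omega> = A (\<theta> t \<omega>))"

definition small_diameter :: "'w measure \<Rightarrow> ('w \<Rightarrow> 'e::metric_space set) \<Rightarrow> bool" where
  "small_diameter M A \<longleftrightarrow>
     (\<forall>\<epsilon>>0. measure M {\<omega>\<in>space M. ediam (A \<omega>) < ennreal \<epsilon>} > 0)"

section \<open>Dynamical hypotheses\<close>

text \<open>The event in the definition of swift transitivity need not belong to \<open>sets M\<close>: for an
  open target ball its complement is a projection along \<open>E\<close>, which is only measurable
  with respect to the completion of \<open>M\<close>. Its probability is therefore taken there. All other
  events in this theory lie in \<open>sets M\<close>, because the suprema can be taken over countable dense
  subsets.\<close>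

definition swift_transitive ::
  "'w measure \<Rightarrow> (real \<Rightarrow> 'w \<Rightarrow> 'e::metric_space \<Rightarrow> 'e) \<Rightarrow> bool" where
  "swift_transitive M \<phi> \<longleftrightarrow>
     (\<forall>x r y. r > 0 \<longrightarrow>
        (\<exists>t>0. measure (completion M) {\<omega>\<in>space M. \<phi> t \<omega> ` ball x r \<subseteq> ball y (2 * r)} > 0))"

definition contracting_on_large_sets ::
  "'w measure \<Rightarrow> (real \<Rightarrow> 'w \<Rightarrow> 'e::metric_space \<Rightarrow> 'e) \<Rightarrow> bool" where
  "contracting_on_large_sets M \<phi> \<longleftrightarrow>
     (\<forall>R>0. \<exists>y. \<exists>t>0.
        measure M {\<omega>\<in>space M. ediam (\<phi> t \<omega> ` ball y R) \<le> ennreal (R / 4)} > 0)"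

definition asymptotically_stable_on ::
  "'w measure \<Rightarrow> (real \<Rightarrow> 'w \<Rightarrow> 'e::metric_space \<Rightarrow> 'e) \<Rightarrow> 'e set \<Rightarrow> bool" where
  "asymptotically_stable_on M \<phi> U \<longleftrightarrow>
     (\<exists>t :: nat \<Rightarrow> real. (\<forall>n. 0 \<le> t n) \<and> incseq t \<and> filterlim t at_top sequentially \<and>
        measure M {\<omega>\<in>space M. (\<lambda>n. ediam (\<phi> (t n) \<omega> ` U)) \<longlonglongrightarrow> 0} > 0)"

section \<open>Attractors and synchronization\<close>

definition weak_attractor ::
  "'w measure \<Rightarrow> (real \<Rightarrow> 'w \<Rightarrow> 'w) \<Rightarrow> (real \<Rightarrow> 'w \<Rightarrow> 'e::metric_space \<Rightarrow> 'e)
     \<Rightarrow> ('w \<Rightarrow> 'e set) \<Rightarrow> bool" where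
  "weak_attractor M \<theta> \<phi> A \<longleftrightarrow>
     random_compact_set M A \<and> phi_invariant M \<theta> \<phi> A \<and>
     (\<forall>B. compact B \<longrightarrow> (\<forall>\<epsilon>>0.
        ((\<lambda>t. measure M {\<omega>\<in>space M.
            (SUP x\<in>B. ennreal (infdist (\<phi> t (\<theta> (- t) \<omega>) x) (A \<omega>))) > ennreal \<epsilon>})
          \<longlongrightarrow> 0) at_top))"

definition synchronization ::
  "'w measure \<Rightarrow> (real \<Rightarrow> 'w \<Rightarrow> 'w) \<Rightarrow> (real \<Rightarrow> 'w \<Rightarrow> 'e::metric_space \<Rightarrow> 'e) \<Rightarrow> bool" where
  "synchronization M \<theta> \<phi> \<longleftrightarrow>
     (\<exists>A. weak_attractor M \<theta> \<phi> A \<and> (AE \<omega> in M. is_singleton (A \<omega>)))"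

end

theory Submission
  imports Defs
begin

text \<open>
  White noise makes the past and the future independent: a set \<open>A\<close> measured by the past does not
  know how the flow will act on it during \<open>[0, t]\<close>. By invariance \<open>A(\<theta>\<^sub>t \<omega>) = \<phi>\<^sub>t(\<omega>, A(\<omega>))\<close>, and
  \<open>\<theta>\<^sub>t\<close> preserves the measure. So if \<open>A\<close> lies in a deterministic set \<open>C\<close> with positive probability
  and the flow does something to \<open>C\<close> with positive probability, then both happen together with
  positive probability, and \<open>A\<close> itself has the resulting property with at least the product of the
  two probabilities (\<open>prob_mult_le_of_shift\<close>). Both conclusions come from repeated use of this remark.

  Small diameter. A compact \<open>A\<close> lies in some ball of radius \<open>r\<close> with positive probability. Choose a
  ball of radius \<open>12r/5\<close> that the flow contracts to diameter at most \<open>3r/5\<close>; swift transitivity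
  carries \<open>A\<close> into it, at the price of a factor slightly above \<open>2\<close>, and after the contraction
  \<open>A\<close> lies in some ball of radius \<open>3r/4\<close> with positive probability. Iterating gives arbitrarily small
  balls.

  Singletons. A set with small diameter is carried into the stable set \<open>U\<close> with positive
  probability. For late enough \<open>t\<^sub>n\<close> the image of \<open>U\<close> at time \<open>t\<^sub>n\<close> has diameter at most \<open>\<epsilon>\<close> with a
  probability bounded below independently of \<open>\<epsilon>\<close>. Hence so does \<open>A\<close>, and letting \<open>\<epsilon> \<rightarrow> 0\<close>, \<open>A\<close> is a
  singleton with positive probability. This event is carried into itself by the shift and depends
  only on the past; an event of this kind has probability \<open>0\<close> or \<open>1\<close> (\<open>zero_one_law\<close>).

  Attractors. A weak attractor is not assumed to be measured by the past, but it is, up to null sets: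
  it lies in a deterministic compact set \<open>K\<close> with probability close to \<open>1\<close>, and the images of \<open>K\<close>
  under the flow started at time \<open>-t\<close>, which depend only on the noise during \<open>[-t, 0]\<close>, contain
  \<open>A\<close> by invariance and are close to \<open>A\<close> by attraction (\<open>past_approximation\<close>). For this reason the
  argument is carried out for the past \<open>\<sigma>\<close>-algebra enlarged by null sets.
\<close>

section \<open>Distances to random sets and their diameters\<close>

lemma ediam_le_iff: "ediam A \<le> c \<longleftrightarrow> (\<forall>a\<in>A. \<forall>b\<in>A. ennreal (dist a b) \<le> c)"
  unfolding ediam_def by (auto simp: SUP_le_iff)

lemma ediam_mono: "A \<subseteq> B \<Longrightarrow> ediam A \<le> ediam B"
  using ediam_le_iff[of A "ediam B"] ediam_le_iff[of B "ediam B"] by blast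

lemma ediam_cball_le:
  assumes "0 \<le> r"
  shows "ediam (cball x r) \<le> ennreal (2 * r)"
proof -
  have "dist a b \<le> 2 * r" if "a \<in> cball x r" "b \<in> cball x r" for a b
    using that dist_triangle3[of a b x] by simp
  then show ?thesis
    by (auto simp: ediam_le_iff intro!: ennreal_leI)
qed

lemma is_singleton_iff_ediam:
  assumes "A \<noteq> {}"
  shows "is_singleton A \<longleftrightarrow> ediam A = 0"
proof
  assume "is_singleton A"
  then show "ediam A = 0"
    by (auto simp: is_singleton_def ediam_def)
next
  assume "ediam A = 0"
  then have "\<forall>a\<in>A. \<forall>b\<in>A. a = b"
    using ediam_le_iff[of A 0] by simp
  with assms show "is_singleton A"
    by (metis is_singletonI' )
qed

lemma ediam_closure: "ediam (closure S) = ediam S"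
proof (rule antisym)
  have cl: "closed {p. ennreal (dist (fst p) (snd p)) \<le> ediam S}"
    by (intro closed_Collect_le continuous_intros continuous_on_ennreal)
  have "closure (S \<times> S) \<subseteq> {p. ennreal (dist (fst p) (snd p)) \<le> ediam S}"
    by (rule closure_minimal[OF _ cl]) (use ediam_le_iff[of S "ediam S"] in auto)
  then show "ediam (closure S) \<le> ediam S"
    unfolding closure_Times ediam_le_iff by auto
  show "ediam S \<le> ediam (closure S)"
    by (rule ediam_mono[OF closure_subset])
qed

text \<open>Diameters of images of arbitrary sets become suprema over countable dense subsets, and are
  therefore measurable whenever the evaluations at single points are.\<close>
lemma ediam_image_dense:
  assumes "continuous_on UNIV f" "T \<subseteq> V" "V \<subseteq> closure T"
  shows "ediam (f ` V) = ediam (f ` T)"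
proof (rule antisym)
  have "f ` V \<subseteq> closure (f ` T)"
    using continuous_image_closure_subset[OF assms(1), of T] assms(3) by blast
  then show "ediam (f ` V) \<le> ediam (f ` T)"
    using ediam_mono ediam_closure by metis
qed (use assms in \<open>auto intro!: ediam_mono\<close>)

lemma ediam_image_countable_measurable:
  fixes f :: "'w \<Rightarrow> 'a \<Rightarrow> 'e::{metric_space, second_countable_topology}"
  assumes "countable T" and [measurable]: "\<And>x. (\<lambda>\<omega>. f \<omega> x) \<in> borel_measurable G"
  shows "(\<lambda>\<omega>. ediam (f \<omega> ` T)) \<in> borel_measurable G"
  unfolding ediam_def image_image using assms(1) by measurable

lemma infdist_greatest:
  assumes "A \<noteq> {}" "\<And>a. a \<in> A \<Longrightarrow> c \<le> dist x a"
  shows "c \<le> infdist x A"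
  using assms by (auto simp: infdist_notempty intro!: cINF_greatest)

text \<open>Both functions of \<open>q\<close> are continuous, so an inequality on a dense set holds everywhere, in
  particular on \<open>A\<close>, where the right-hand side vanishes. This and the next lemma express
  properties of \<open>A\<close> by countably many values of the distance to \<open>A\<close>, the only data about a random set
  that are assumed measurable.\<close>
lemma subset_closed_iff_infdist:
  assumes "closure D = UNIV" "closed C" "C \<noteq> {}" "A \<noteq> {}"
  shows "A \<subseteq> C \<longleftrightarrow> (\<forall>q\<in>D. infdist q C \<le> infdist q A)"
proof
  show "A \<subseteq> C \<Longrightarrow> \<forall>q\<in>D. infdist q C \<le> infdist q A"
    using assms(4) by (auto intro: infdist_mono)
next
  assume le: "\<forall>q\<in>D. infdist q C \<le> infdist q A"
  have "closure D \<subseteq> {q. infdist q C \<le> infdist q A}"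
    by (rule closure_minimal) (use le in \<open>auto intro!: closed_Collect_le continuous_intros\<close>)
  then have "infdist a C \<le> infdist a A" for a
    using assms(1) by auto
  then have "infdist a C = 0" if "a \<in> A" for a
    using that infdist_nonneg[of a C] infdist_zero[of a A] by (metis order_antisym)
  then show "A \<subseteq> C"
    using in_closed_iff_infdist_zero[OF assms(2,3)] by blast
qed

text \<open>The triangle inequality through near-optimal points of \<open>A\<close> gives one direction; for the
  other, the inequality extends by continuity from the dense set to points of \<open>A\<close>, where both
  distances to \<open>A\<close> vanish.\<close>
lemma ediam_le_iff_infdist:
  assumes "closure D = UNIV" "A \<noteq> {}" "0 \<le> c"
  shows "ediam A \<le> ennreal c \<longleftrightarrow> (\<forall>p\<in>D. \<forall>q\<in>D. dist p q \<le> c + infdist p A + infdist q A)"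
proof
  assume "ediam A \<le> ennreal c"
  then have le: "dist a b \<le> c" if "a \<in> A" "b \<in> A" for a b
    using that assms(3) by (auto simp: ediam_le_iff)
  have "dist p q \<le> c + infdist p A + infdist q A" for p q
  proof -
    have "dist p q - c - dist q b \<le> infdist p A" if "b \<in> A" for b
    proof (rule infdist_greatest[OF assms(2)])
      fix a assume "a \<in> A"
      have "dist p q \<le> dist p a + dist a b + dist q b"
        by (metis add.commute add_left_mono dist_commute dist_triangle dist_triangle_le)
      then show "dist p q - c - dist q b \<le> dist p a"
        using le[OF \<open>a \<in> A\<close> \<open>b \<in> A\<close>] by linarith
    qed
    then have "dist p q - c - infdist p A \<le> infdist q A"
      by (intro infdist_greatest[OF assms(2)]) (smt (verit))
    then show ?thesis by linarith
  qed
  then show "\<forall>p\<in>D. \<forall>q\<in>D. dist p q \<le> c + infdist p A + infdist q A" by blast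
next
  let ?Z = "{z. dist (fst z) (snd z) \<le> c + infdist (fst z) A + infdist (snd z) A}"
  assume "\<forall>p\<in>D. \<forall>q\<in>D. dist p q \<le> c + infdist p A + infdist q A"
  then have "closure (D \<times> D) \<subseteq> ?Z"
    by (intro closure_minimal closed_Collect_le continuous_intros) auto
  then have "UNIV \<subseteq> ?Z"
    using assms(1) by (simp add: closure_Times)
  then have "(a, b) \<in> ?Z" for a b
    by blast
  then have "dist a b \<le> c" if "a \<in> A" "b \<in> A" for a b
    using that by (metis (mono_tags, lifting) add.right_neutral fst_conv infdist_zero mem_Collect_eq snd_conv)
  then show "ediam A \<le> ennreal c"
    by (auto simp: ediam_le_iff intro!: ennreal_leI)
qed

text \<open>The image \<open>f ` K\<close> contains \<open>A\<close> and stays within \<open>\<delta>\<close> of it, so the two sets have almost the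
  same distance to any point; the dense subset \<open>T\<close> of \<open>K\<close>, countable in the application, makes the
  left-hand distance measurable in the flow.\<close>
lemma infdist_image_near:
  assumes A: "A \<noteq> {}" "A \<subseteq> f ` K" and T: "T \<subseteq> K" "K \<subseteq> closure T"
    and f: "continuous_on UNIV f"
    and near: "\<And>y. y \<in> K \<Longrightarrow> infdist (f y) A \<le> \<delta>"
  shows "\<bar>infdist x (f ` T) - infdist x A\<bar> \<le> \<delta>"
proof -
  have "K \<noteq> {}" using A by blast
  then have "T \<noteq> {}" using T(2) by auto
  have "infdist x A - \<delta> \<le> infdist x (f ` T)"
  proof (rule infdist_greatest)
    fix z assume "z \<in> f ` T"
    then have "infdist z A \<le> \<delta>" using near T(1) by auto
    then show "infdist x A - \<delta> \<le> dist x z"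
      using infdist_triangle[of x A z] by linarith
  qed (use \<open>T \<noteq> {}\<close> in simp)
  moreover have "f ` K \<subseteq> closure (f ` T)"
    using continuous_image_closure_subset[OF f, of T] T(2) by blast
  then have "infdist x (closure (f ` T)) \<le> infdist x A"
    using A by (intro infdist_mono) auto
  then have "infdist x (f ` T) \<le> infdist x A"
    by (simp add: infdist_eq_setdist)
  moreover have "0 \<le> \<delta>"
    using \<open>K \<noteq> {}\<close> order_trans[OF infdist_nonneg near] by blast
  ultimately show ?thesis by linarith
qed

lemma subset_closed_event:
  fixes A :: "'w \<Rightarrow> 'e::{metric_space, second_countable_topology} set"
  assumes ne: "\<And>\<omega>. \<omega> \<in> space G \<Longrightarrow> A \<omega> \<noteq> {}"
    and [measurable]: "\<And>x. (\<lambda>\<omega>. infdist x (A \<omega>)) \<in> borel_measurable G"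
    and "closed C" "C \<noteq> {}"
  shows "{\<omega> \<in> space G. A \<omega> \<subseteq> C} \<in> sets G"
proof -
  obtain D :: "'e set" where D: "countable D" "UNIV \<subseteq> closure D"
    by (rule separable[of UNIV]) auto
  then have [measurable]: "{\<omega> \<in> space G. \<forall>q\<in>D. infdist q C \<le> infdist q (A \<omega>)} \<in> sets G"
    by (intro sets.sets_Collect_countable_All') auto
  have "{\<omega> \<in> space G. A \<omega> \<subseteq> C} = {\<omega> \<in> space G. \<forall>q\<in>D. infdist q C \<le> infdist q (A \<omega>)}"
    using subset_closed_iff_infdist[of D C] D assms by (intro Collect_cong) (metis top.extremum_uniqueI)
  then show ?thesis by simp
qed

lemma ediam_measurable:
  fixes A :: "'w \<Rightarrow> 'e::{metric_space, second_countable_topology} set"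
  assumes ne: "\<And>\<omega>. \<omega> \<in> space G \<Longrightarrow> A \<omega> \<noteq> {}"
    and [measurable]: "\<And>x. (\<lambda>\<omega>. infdist x (A \<omega>)) \<in> borel_measurable G"
  shows "(\<lambda>\<omega>. ediam (A \<omega>)) \<in> borel_measurable G"
proof (rule borel_measurableI_le)
  fix y :: ennreal
  obtain D :: "'e set" where D: "countable D" "UNIV \<subseteq> closure D"
    by (rule separable[of UNIV]) auto
  show "{\<omega> \<in> space G. ediam (A \<omega>) \<le> y} \<in> sets G"
  proof (cases y)
    case (real c)
    have "{\<omega> \<in> space G. \<forall>p\<in>D. \<forall>q\<in>D. dist p q \<le> c + infdist p (A \<omega>) + infdist q (A \<omega>)} \<in> sets G"
      using D(1) by (intro sets.sets_Collect_countable_All') auto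
    moreover have "{\<omega> \<in> space G. ediam (A \<omega>) \<le> y} =
        {\<omega> \<in> space G. \<forall>p\<in>D. \<forall>q\<in>D. dist p q \<le> c + infdist p (A \<omega>) + infdist q (A \<omega>)}"
      using ediam_le_iff_infdist[of D] D(2) ne real
      by (intro Collect_cong) (metis top.extremum_uniqueI)
    ultimately show ?thesis by simp
  qed simp
qed

text \<open>The distance to a set is \<open>1\<close>-Lipschitz, hence the infimum of countably many cones with apexes
  on a dense set; the apexes do not depend on the sample point.\<close>
lemma infdist_measurable_compose:
  fixes A :: "'w \<Rightarrow> 'e::{metric_space, second_countable_topology} set"
  assumes ne: "\<And>\<omega>. \<omega> \<in> space G \<Longrightarrow> A \<omega> \<noteq> {}"
    and [measurable]: "\<And>x. (\<lambda>\<omega>. infdist x (A \<omega>)) \<in> borel_measurable G"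
    and [measurable]: "f \<in> borel_measurable G"
  shows "(\<lambda>\<omega>. infdist (f \<omega>) (A \<omega>)) \<in> borel_measurable G"
proof -
  obtain D :: "'e set" where D: "countable D" "UNIV \<subseteq> closure D"
    by (rule separable[of UNIV]) auto
  then have "D \<noteq> {}" by auto
  have inf_conv: "infdist y S = (INF q\<in>D. dist y q + infdist q S)" for y :: 'e and S
  proof (rule antisym)
    show "infdist y S \<le> (INF q\<in>D. dist y q + infdist q S)"
      using \<open>D \<noteq> {}\<close> infdist_triangle[of y S] by (intro cINF_greatest) (auto simp: add.commute)
    show "(INF q\<in>D. dist y q + infdist q S) \<le> infdist y S"
    proof (rule field_le_epsilon)
      fix e :: real assume "0 < e"
      have "y \<in> closure D" using D(2) by auto
      moreover have "0 < e / 2" using \<open>0 < e\<close> by simp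
      ultimately obtain q where q: "q \<in> D" "dist q y < e / 2"
        using closure_approachable[of y D] by blast
      have "(INF q\<in>D. dist y q + infdist q S) \<le> dist y q + infdist q S"
        by (rule cINF_lower[OF _ q(1)]) (auto intro!: bdd_belowI[of _ 0] simp: infdist_nonneg)
      also have "\<dots> \<le> infdist y S + e"
        using q(2) infdist_triangle[of q S y] by (simp add: dist_commute)
      finally show "(INF q\<in>D. dist y q + infdist q S) \<le> infdist y S + e" .
    qed
  qed
  have "(\<lambda>\<omega>. infdist (f \<omega>) (A \<omega>)) = (\<lambda>\<omega>. INF q\<in>D. dist (f \<omega>) q + infdist q (A \<omega>))"
    by (rule ext) (rule inf_conv)
  moreover have "(\<lambda>\<omega>. INF q\<in>D. dist (f \<omega>) q + infdist q (A \<omega>)) \<in> borel_measurable G"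
    using D(1) by measurable
  ultimately show ?thesis by (simp only:)
qed

lemma (in prob_space) countable_cover_positive:
  assumes "countable I" "\<And>i. i \<in> I \<Longrightarrow> S i \<in> events" "AE \<omega> in M. \<exists>i\<in>I. \<omega> \<in> S i"
  shows "\<exists>i\<in>I. 0 < prob (S i)"
proof (rule ccontr)
  assume "\<not> ?thesis"
  then have "prob (S i) = 0" if "i \<in> I" for i
    using that measure_nonneg[of M "S i"] by (meson linorder_not_less order_antisym)
  then have "AE \<omega> in M. \<omega> \<notin> S i" if "i \<in> I" for i
    using prob_eq_0[OF assms(2)] that by blast
  then have "AE \<omega> in M. \<forall>i\<in>I. \<omega> \<notin> S i"
    using assms(1) by (intro AE_ball_countable')
  with assms(3) have "AE \<omega> in M. False" by eventually_elim blast
  then show False by simp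
qed

section \<open>Shift, past and future\<close>

context white_noise_rds
begin

lemma theta_fixed_measurable [measurable]: "\<theta> t \<in> measurable M M"
proof -
  have "(\<lambda>\<omega>. (\<lambda>(t, \<omega>). \<theta> t \<omega>) (t, \<omega>)) \<in> measurable M M"
    by (rule measurable_compose[OF _ theta_measurable]) measurable
  then show ?thesis by simp
qed

lemma theta_in_space: "\<omega> \<in> space M \<Longrightarrow> \<theta> t \<omega> \<in> space M"
  using measurable_space[OF theta_fixed_measurable] .

lemma prob_theta_vimage: "X \<in> events \<Longrightarrow> prob (\<theta> t -` X \<inter> space M) = prob X"
  using measure_distr[OF theta_fixed_measurable, of X t] theta_invariant[of t] by simp

lemma AE_theta: "AE \<omega> in M. P \<omega> \<Longrightarrow> AE \<omega> in M. P (\<theta> t \<omega>)"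
  by (rule AE_distrD[OF theta_fixed_measurable, unfolded theta_invariant])

lemma space_F: "s \<le> t \<Longrightarrow> space (\<F> s t) = space M"
  and sets_F: "s \<le> t \<Longrightarrow> sets (\<F> s t) \<subseteq> events"
  using F_subalgebra[of s t] by (auto simp: subalgebra_def)

text \<open>Starting the flow at time \<open>-t\<close> and observing it at time \<open>0\<close> uses only the noise during
  \<open>[-t, 0]\<close>.\<close>
lemma phi_pullback_measurable:
  assumes "0 \<le> t"
  shows "(\<lambda>\<omega>. \<phi> t (\<theta> (- t) \<omega>) x) \<in> borel_measurable (\<F> (- t) 0)"
proof (rule measurableI)
  fix B :: "'e set" assume "B \<in> sets borel"
  then have "(\<lambda>\<omega>. \<phi> t \<omega> x) -` B \<inter> space M \<in> sets (\<F> 0 t)"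
    using measurable_sets[OF phi_adapted[OF assms, of x]] space_F[OF assms] by simp
  then have "\<theta> (- t) -` ((\<lambda>\<omega>. \<phi> t \<omega> x) -` B \<inter> space M) \<inter> space M \<in> sets (\<F> (- t) 0)"
    using F_shift[OF assms, of "- t"] by (metis (no_types, lifting) add.right_inverse add_0 imageI)
  moreover have "\<theta> (- t) -` ((\<lambda>\<omega>. \<phi> t \<omega> x) -` B \<inter> space M) \<inter> space M =
      (\<lambda>\<omega>. \<phi> t (\<theta> (- t) \<omega>) x) -` B \<inter> space (\<F> (- t) 0)"
    using assms by (auto simp: space_F theta_in_space)
  ultimately show "(\<lambda>\<omega>. \<phi> t (\<theta> (- t) \<omega>) x) -` B \<inter> space (\<F> (- t) 0) \<in> sets (\<F> (- t) 0)"
    by simp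
qed simp

lemma past_generator_subset: "(\<Union>s\<in>{..0}. sets (\<F> s 0)) \<subseteq> events"
  using sets_F by auto

lemma sets_past: "sets (past_algebra M \<F>) = sigma_sets (space M) (\<Union>s\<in>{..0}. sets (\<F> s 0))"
  unfolding past_algebra_def using past_generator_subset sets.sets_into_space
  by (intro sets_measure_of) blast

lemma space_past [simp]: "space (past_algebra M \<F>) = space M"
  unfolding past_algebra_def by (rule space_measure_of_conv)

lemma past_subset: "sets (past_algebra M \<F>) \<subseteq> events"
  unfolding sets_past using past_generator_subset by (rule sets.sigma_sets_subset)

lemma F_subset_past: "s \<le> 0 \<Longrightarrow> sets (\<F> s 0) \<subseteq> sets (past_algebra M \<F>)"
  unfolding sets_past by blast

lemma past_generator_Int_stable: "Int_stable (\<Union>s\<in>{..0}. sets (\<F> s 0))"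
proof (rule Int_stableI)
  fix a b assume "a \<in> (\<Union>s\<in>{..0}. sets (\<F> s 0))" "b \<in> (\<Union>s\<in>{..0}. sets (\<F> s 0))"
  then obtain s r where *: "s \<le> 0" "a \<in> sets (\<F> s 0)" "r \<le> 0" "b \<in> sets (\<F> r 0)" by auto
  then have "a \<in> sets (\<F> (min s r) 0)" "b \<in> sets (\<F> (min s r) 0)"
    using F_mono[of "min s r" s 0 0] F_mono[of "min s r" r 0 0] by auto
  then have "a \<inter> b \<in> sets (\<F> (min s r) 0)" by (rule sets.Int)
  with * show "a \<inter> b \<in> (\<Union>s\<in>{..0}. sets (\<F> s 0))" by auto
qed

lemma past_future_indep:
  assumes "0 \<le> t" "X \<in> sets (past_algebra M \<F>)" "Y \<in> sets (\<F> 0 t)"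
  shows "prob (X \<inter> Y) = prob X * prob Y"
proof -
  have "indep_set (\<Union>s\<in>{..0}. sets (\<F> s 0)) (sets (\<F> 0 t))"
    using F_indep[of _ 0 0 t] assms(1) past_generator_subset sets_F[OF assms(1)]
    by (intro indep_setI) (auto dest: indep_setD)
  then have "indep_set (sigma_sets (space M) (\<Union>s\<in>{..0}. sets (\<F> s 0)))
      (sigma_sets (space M) (sets (\<F> 0 t)))"
    by (rule indep_set_sigma_sets[OF _ past_generator_Int_stable sets.Int_stable])
  then show ?thesis
    using assms(2,3) unfolding sets_past by (auto dest: indep_setD)
qed

text \<open>The completion of the past by the null sets of \<open>M\<close>, which is larger than its completion as a
  measure space of its own: a weak attractor agrees only almost surely with a set measured by the
  past, and the exceptional null set need not be covered by a null set of the past.\<close>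
definition past_mod_null :: "'w measure" where
  "past_mod_null = sigma (space M)
     {X \<in> events. \<exists>Y\<in>sets (past_algebra M \<F>). AE \<omega> in M. \<omega> \<in> X \<longleftrightarrow> \<omega> \<in> Y}"

lemma space_past_mod_null [simp]: "space past_mod_null = space M"
  unfolding past_mod_null_def by (rule space_measure_of_conv)

lemma sets_past_mod_null:
  "sets past_mod_null =
     {X \<in> events. \<exists>Y\<in>sets (past_algebra M \<F>). AE \<omega> in M. \<omega> \<in> X \<longleftrightarrow> \<omega> \<in> Y}" (is "_ = ?S")
proof -
  have "sigma_algebra (space M) ?S"
    unfolding sigma_algebra_iff2
  proof (intro conjI ballI allI impI)
    show "?S \<subseteq> Pow (space M)" using sets.sets_into_space by auto
    show "{} \<in> ?S" by (auto intro!: bexI[of _ "{}"])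
  next
    fix X assume "X \<in> ?S"
    then obtain Y where XY: "X \<in> events" "Y \<in> sets (past_algebra M \<F>)"
      "AE \<omega> in M. \<omega> \<in> X \<longleftrightarrow> \<omega> \<in> Y" by blast
    have "AE \<omega> in M. \<omega> \<in> space M - X \<longleftrightarrow> \<omega> \<in> space M - Y"
      using XY(3) by eventually_elim auto
    moreover have "space M - Y \<in> sets (past_algebra M \<F>)" "space M - X \<in> events"
      using XY(1) sets.compl_sets[OF XY(2)] by auto
    ultimately show "space M - X \<in> ?S"
      by blast
  next
    fix X :: "nat \<Rightarrow> 'w set" assume X: "range X \<subseteq> ?S"
    then have "\<forall>n. \<exists>Y. Y \<in> sets (past_algebra M \<F>) \<and> (AE \<omega> in M. \<omega> \<in> X n \<longleftrightarrow> \<omega> \<in> Y)"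
      by blast
    then obtain Y where Y: "\<And>n. Y n \<in> sets (past_algebra M \<F>)"
      "\<And>n. AE \<omega> in M. \<omega> \<in> X n \<longleftrightarrow> \<omega> \<in> Y n" by metis
    have "AE \<omega> in M. \<forall>n. \<omega> \<in> X n \<longleftrightarrow> \<omega> \<in> Y n"
      using Y(2) by (simp add: AE_all_countable)
    then have "AE \<omega> in M. \<omega> \<in> (\<Union>n. X n) \<longleftrightarrow> \<omega> \<in> (\<Union>n. Y n)"
      by eventually_elim auto
    moreover have "(\<Union>n. Y n) \<in> sets (past_algebra M \<F>)" "(\<Union>n. X n) \<in> events"
      using X Y(1) by auto
    ultimately show "(\<Union>n. X n) \<in> ?S" by blast
  qed
  then show ?thesis
    unfolding past_mod_null_def by (rule sigma_algebra.sets_measure_of_eq)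
qed

lemma past_mod_null_events: "X \<in> sets past_mod_null \<Longrightarrow> X \<in> events"
  by (simp add: sets_past_mod_null)

lemma borel_measurable_past_mod_null_AE:
  fixes f :: "'w \<Rightarrow> 'x::topological_space"
  assumes f: "f \<in> borel_measurable M" and g: "g \<in> borel_measurable (past_algebra M \<F>)"
    and eq: "AE \<omega> in M. f \<omega> = g \<omega>"
  shows "f \<in> borel_measurable past_mod_null"
proof (rule measurableI)
  fix B :: "'x set" assume B: "B \<in> sets borel"
  have "AE \<omega> in M. \<omega> \<in> f -` B \<inter> space M \<longleftrightarrow> \<omega> \<in> g -` B \<inter> space M"
    using eq by eventually_elim auto
  then show "f -` B \<inter> space past_mod_null \<in> sets past_mod_null"
    using measurable_sets[OF f B] measurable_sets[OF g B]
    unfolding sets_past_mod_null space_past_mod_null space_past by blast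
qed simp

lemma borel_measurable_past_mod_null:
  assumes "f \<in> borel_measurable (past_algebra M \<F>)"
  shows "f \<in> borel_measurable past_mod_null"
proof (rule borel_measurable_past_mod_null_AE[OF _ assms])
  show "f \<in> borel_measurable M"
    by (rule measurable_from_subalg[OF _ assms]) (simp add: subalgebra_def past_subset)
qed simp

lemma past_mod_null_future_indep:
  assumes "0 \<le> t" "X \<in> sets past_mod_null" "Y \<in> sets (\<F> 0 t)"
  shows "prob (X \<inter> Y) = prob X * prob Y"
proof -
  obtain X' where X': "X' \<in> sets (past_algebra M \<F>)" "AE \<omega> in M. \<omega> \<in> X \<longleftrightarrow> \<omega> \<in> X'"
    and X: "X \<in> events"
    using assms(2) by (auto simp: sets_past_mod_null)
  have Y: "Y \<in> events" and X'e: "X' \<in> events"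
    using assms sets_F past_subset X' by auto
  have "prob (X \<inter> Y) = prob (X' \<inter> Y)" "prob X = prob X'"
    using X'(2) X Y X'e by (auto intro!: finite_measure_eq_AE)
  then show ?thesis
    using past_future_indep[OF assms(1) X'(1) assms(3)] by simp
qed

text \<open>The basic tool: a past event \<open>X\<close> and a future event \<open>Y\<close> are independent, and if together they
  force \<open>Z\<close> after time \<open>t\<close>, then \<open>Z\<close> inherits the product of their probabilities, because the shift
  preserves the measure.\<close>
lemma prob_mult_le_of_shift:
  assumes "0 \<le> t" "X \<in> sets past_mod_null" "Y \<in> sets (\<F> 0 t)" "Z \<in> events"
    and "AE \<omega> in M. \<omega> \<in> X \<longrightarrow> \<omega> \<in> Y \<longrightarrow> \<theta> t \<omega> \<in> Z"
  shows "prob X * prob Y \<le> prob Z"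
proof -
  have "prob X * prob Y = prob (X \<inter> Y)"
    using past_mod_null_future_indep[OF assms(1-3)] by simp
  also have "\<dots> \<le> prob (\<theta> t -` Z \<inter> space M)"
  proof (rule finite_measure_mono_AE)
    show "AE \<omega> in M. \<omega> \<in> X \<inter> Y \<longrightarrow> \<omega> \<in> \<theta> t -` Z \<inter> space M"
      using assms(5) AE_space by eventually_elim auto
  qed (use assms(4) in measurable)
  also have "\<dots> = prob Z" by (rule prob_theta_vimage[OF assms(4)])
  finally show ?thesis .
qed

text \<open>By measure preservation \<open>X\<close> is even invariant up to null sets. An event \<open>B\<close> of the noise
  during \<open>[s, 0]\<close> is moved by the shift to an event during \<open>[0, -s]\<close>, which is independent of \<open>X\<close>,
  whereas \<open>X\<close> does not move. So \<open>X\<close> is independent of the whole past, to which it belongs up to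
  a null set.\<close>
lemma zero_one_law:
  assumes X: "X \<in> sets past_mod_null"
    and forward: "\<And>t. 0 \<le> t \<Longrightarrow> AE \<omega> in M. \<omega> \<in> X \<longrightarrow> \<theta> t \<omega> \<in> X"
  shows "prob X = 0 \<or> prob X = 1"
proof -
  have Xe: "X \<in> events" by (rule past_mod_null_events[OF X])
  have inv: "AE \<omega> in M. \<theta> t \<omega> \<in> X \<longleftrightarrow> \<omega> \<in> X" if "0 \<le> t" for t
  proof -
    let ?X = "\<theta> t -` X \<inter> space M"
    have e: "?X \<in> events" using Xe by measurable
    have "prob (?X \<inter> X) = prob X"
      using forward[OF that] AE_space e Xe
      by (intro finite_measure_eq_AE) (auto elim: eventually_elim2)
    then have "prob (?X - X) = 0"
      using finite_measure_Diff'[OF e Xe] prob_theta_vimage[OF Xe] by simp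
    then have "AE \<omega> in M. \<omega> \<notin> ?X - X"
      using prob_eq_0[of "?X - X"] e Xe by blast
    with forward[OF that] AE_space show ?thesis
      by eventually_elim auto
  qed
  have "indep_set {X} (\<Union>s\<in>{..0}. sets (\<F> s 0))"
  proof (rule indep_setI)
    fix X' B assume "X' \<in> {X}" "B \<in> (\<Union>s\<in>{..0}. sets (\<F> s 0))"
    then obtain s where [simp]: "X' = X" and s: "s \<le> 0" and B: "B \<in> sets (\<F> s 0)" by auto
    let ?C = "\<theta> (- s) -` B \<inter> space M"
    have C: "?C \<in> sets (\<F> 0 (- s))"
      using F_shift[OF s, of "- s"] B by auto
    have Be: "B \<in> events" using B sets_F[OF s] by auto
    have "prob (X \<inter> B) = prob (\<theta> (- s) -` (X \<inter> B) \<inter> space M)"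
      using prob_theta_vimage[of "X \<inter> B" "- s"] Xe Be by simp
    also have "\<dots> = prob (X \<inter> ?C)"
    proof (rule finite_measure_eq_AE)
      show "AE \<omega> in M. \<omega> \<in> \<theta> (- s) -` (X \<inter> B) \<inter> space M \<longleftrightarrow> \<omega> \<in> X \<inter> ?C"
        using inv[of "- s"] s by (auto elim: eventually_mono)
    qed (use Xe Be in measurable)
    also have "\<dots> = prob X * prob ?C"
      using past_mod_null_future_indep[OF _ X C] s by simp
    also have "prob ?C = prob B" by (rule prob_theta_vimage[OF Be])
    finally show "prob (X' \<inter> B) = prob X' * prob B" by simp
  qed (use Xe past_generator_subset in auto)
  then have indep: "indep_set (sigma_sets (space M) {X}) (sets (past_algebra M \<F>))"
    unfolding sets_past
    by (rule indep_set_sigma_sets[OF _ _ past_generator_Int_stable]) (auto simp: Int_stable_def)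
  obtain Y where Y: "Y \<in> sets (past_algebra M \<F>)" "AE \<omega> in M. \<omega> \<in> X \<longleftrightarrow> \<omega> \<in> Y"
    using X by (auto simp: sets_past_mod_null)
  then have "Y \<in> events" using past_subset by blast
  then have "prob Y = prob X" "prob (X \<inter> Y) = prob X"
    using Y(2) Xe by (auto intro!: finite_measure_eq_AE)
  then have "prob X = prob X * prob X"
    using indep_setD[OF indep _ Y(1), of X] by auto
  then show ?thesis by auto
qed

section \<open>Images of deterministic sets\<close>

lemma ediam_image_measurable:
  assumes "0 \<le> t"
  shows "(\<lambda>\<omega>. ediam (\<phi> t \<omega> ` V)) \<in> borel_measurable (\<F> 0 t)"
proof -
  obtain T where T: "countable T" "T \<subseteq> V" "V \<subseteq> closure T" by (rule separable)
  have "ediam (\<phi> t \<omega> ` V) = ediam (\<phi> t \<omega> ` T)" if "\<omega> \<in> space (\<F> 0 t)" for \<omega>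
    using ediam_image_dense[OF phi_continuous T(2,3)] assms that space_F by simp
  then show ?thesis
    using ediam_image_countable_measurable[OF T(1) phi_adapted[OF assms]]
    by (simp cong: measurable_cong)
qed

lemma image_subset_closed_event:
  assumes "0 \<le> t" "closed C"
  shows "{\<omega> \<in> space M. \<phi> t \<omega> ` V \<subseteq> C} \<in> sets (\<F> 0 t)"
proof -
  obtain T where T: "countable T" "T \<subseteq> V" "V \<subseteq> closure T" by (rule separable)
  have [measurable]: "C \<in> sets borel" using assms(2) by simp
  have [measurable]: "(\<lambda>\<omega>. \<phi> t \<omega> x) \<in> borel_measurable (\<F> 0 t)" for x
    by (rule phi_adapted[OF assms(1)])
  have "{\<omega> \<in> space (\<F> 0 t). \<forall>x\<in>T. \<phi> t \<omega> x \<in> C} \<in> sets (\<F> 0 t)"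
    using T(1) by (intro sets.sets_Collect_countable_All') auto
  moreover have "\<phi> t \<omega> ` V \<subseteq> C \<longleftrightarrow> (\<forall>x\<in>T. \<phi> t \<omega> x \<in> C)" if "\<omega> \<in> space M" for \<omega>
    using image_closure_subset[of T "\<phi> t \<omega>" C] T assms phi_continuous[OF that assms(1)]
      continuous_on_subset[of UNIV] by blast
  then have "{\<omega> \<in> space M. \<phi> t \<omega> ` V \<subseteq> C} = {\<omega> \<in> space (\<F> 0 t). \<forall>x\<in>T. \<phi> t \<omega> x \<in> C}"
    using space_F[OF assms(1)] by auto
  ultimately show ?thesis by simp
qed

text \<open>Closing the target ball replaces a possibly non-measurable event by a larger one that is
  measured by the noise during \<open>[0, t]\<close>, so that independence applies to it.\<close>
lemma swift_transitive_cball: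
  assumes "swift_transitive M \<phi>" "0 < r"
  shows "\<exists>t>0. 0 < prob {\<omega> \<in> space M. \<phi> t \<omega> ` ball x r \<subseteq> cball y (2 * r)}"
proof -
  obtain t where t: "t > 0"
    and pos: "0 < measure (completion M) {\<omega> \<in> space M. \<phi> t \<omega> ` ball x r \<subseteq> ball y (2 * r)}"
    (is "0 < measure _ ?S")
    using assms unfolding swift_transitive_def by blast
  let ?G = "{\<omega> \<in> space M. \<phi> t \<omega> ` ball x r \<subseteq> cball y (2 * r)}"
  have G: "?G \<in> events"
    using image_subset_closed_event[of t "cball y (2 * r)" "ball x r"] sets_F[of 0 t] t by auto
  have S: "?S \<in> sets (completion M)"
    using pos measure_notin_sets by fastforce
  interpret c: prob_space "completion M" by (rule prob_space_completion)
  have "measure (completion M) ?S \<le> measure (completion M) ?G"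
    using G by (intro c.finite_measure_mono) (auto dest: ball_subset_cball[THEN subsetD])
  then show ?thesis
    using pos t G by (intro exI[of _ t]) auto
qed

text \<open>On the event of asymptotic stability, of probability \<open>2p\<close>, the diameter is eventually below
  \<open>\<epsilon>\<close>. By continuity of the measure some fixed late time has this property with probability at
  least \<open>p\<close>, a bound in which \<open>\<epsilon>\<close> no longer appears.\<close>
lemma stable_uniform_contraction:
  assumes "asymptotically_stable_on M \<phi> U"
  shows "\<exists>p>0. \<forall>\<epsilon>>0. \<exists>t\<ge>0. p \<le> prob {\<omega> \<in> space M. ediam (\<phi> t \<omega> ` U) \<le> ennreal \<epsilon>}"
proof -
  obtain t :: "nat \<Rightarrow> real" where t: "\<And>n. 0 \<le> t n"
    and pos: "0 < prob {\<omega> \<in> space M. (\<lambda>n. ediam (\<phi> (t n) \<omega> ` U)) \<longlonglongrightarrow> 0}" (is "0 < prob ?S")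
    using assms unfolding asymptotically_stable_on_def by blast
  have [measurable]: "(\<lambda>\<omega>. ediam (\<phi> (t n) \<omega> ` U)) \<in> borel_measurable M" for n
    by (rule measurable_from_subalg[OF F_subalgebra ediam_image_measurable]) (rule t)+
  show ?thesis
  proof (rule exI[of _ "prob ?S / 2"], intro conjI allI impI)
    fix \<epsilon> :: real assume "0 < \<epsilon>"
    let ?B = "\<lambda>N. {\<omega> \<in> space M. \<forall>n\<ge>N. ediam (\<phi> (t n) \<omega> ` U) \<le> ennreal \<epsilon>}"
    have "(\<lambda>N. prob (?B N)) \<longlonglongrightarrow> prob (\<Union>N. ?B N)"
      by (rule finite_Lim_measure_incseq) (auto simp: incseq_def)
    moreover have "?S \<subseteq> (\<Union>N. ?B N)"
    proof
      fix \<omega> assume \<omega>: "\<omega> \<in> ?S"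
      then have "eventually (\<lambda>n. ediam (\<phi> (t n) \<omega> ` U) < ennreal \<epsilon>) sequentially"
        using \<open>0 < \<epsilon>\<close> by (intro order_tendstoD(2)[where y = 0]) auto
      then obtain N where "\<forall>n\<ge>N. ediam (\<phi> (t n) \<omega> ` U) < ennreal \<epsilon>"
        by (auto simp: eventually_sequentially)
      then show "\<omega> \<in> (\<Union>N. ?B N)" using \<omega> less_imp_le by blast
    qed
    then have "prob ?S \<le> prob (\<Union>N. ?B N)"
      by (intro finite_measure_mono) auto
    then have "prob ?S / 2 < prob (\<Union>N. ?B N)" using pos by linarith
    ultimately have "eventually (\<lambda>N. prob ?S / 2 < prob (?B N)) sequentially"
      by (rule order_tendstoD)
    then obtain N where "prob ?S / 2 < prob (?B N)"
      by (auto simp: eventually_sequentially)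
    also have "\<dots> \<le> prob {\<omega> \<in> space M. ediam (\<phi> (t N) \<omega> ` U) \<le> ennreal \<epsilon>}"
      by (intro finite_measure_mono) auto
    finally show "\<exists>t\<ge>0. prob ?S / 2 \<le> prob {\<omega> \<in> space M. ediam (\<phi> t \<omega> ` U) \<le> ennreal \<epsilon>}"
      using t by (intro exI[of _ "t N"]) auto
  qed (use pos in simp)
qed

end

section \<open>Invariant random sets that are independent of the future\<close>

text \<open>The distance to \<open>A\<close> determines \<open>A\<close> only up to closure, which is enough for the two kinds of
  events considered: inclusions of \<open>A\<close> in closed sets, and bounds on its diameter.\<close>
locale invariant_random_set = white_noise_rds M \<theta> \<phi> \<F>
  for M :: "'w measure" and \<theta> :: "real \<Rightarrow> 'w \<Rightarrow> 'w"
    and \<phi> :: "real \<Rightarrow> 'w \<Rightarrow> 'e::polish_space \<Rightarrow> 'e"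
    and \<F> :: "real \<Rightarrow> real \<Rightarrow> 'w measure" +
  fixes A :: "'w \<Rightarrow> 'e set"
  assumes A_nonempty: "\<omega> \<in> space M \<Longrightarrow> A \<omega> \<noteq> {}"
    and A_past: "(\<lambda>\<omega>. infdist x (A \<omega>)) \<in> borel_measurable past_mod_null"
    and A_invariant: "phi_invariant M \<theta> \<phi> A"
begin

lemma A_subset_past: "closed C \<Longrightarrow> C \<noteq> {} \<Longrightarrow> {\<omega> \<in> space M. A \<omega> \<subseteq> C} \<in> sets past_mod_null"
  using subset_closed_event[of past_mod_null A C] A_nonempty A_past by simp

lemma A_subset_event: "closed C \<Longrightarrow> C \<noteq> {} \<Longrightarrow> {\<omega> \<in> space M. A \<omega> \<subseteq> C} \<in> events"
  using A_subset_past past_mod_null_events by blast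

lemma A_ediam_past: "(\<lambda>\<omega>. ediam (A \<omega>)) \<in> borel_measurable past_mod_null"
  using ediam_measurable[of past_mod_null A] A_nonempty A_past by simp

lemma A_ediam_measurable [measurable]: "(\<lambda>\<omega>. ediam (A \<omega>)) \<in> borel_measurable M"
  by (rule measurable_from_subalg[OF _ A_ediam_past])
     (auto simp: subalgebra_def past_mod_null_events)

lemma A_image: "0 \<le> t \<Longrightarrow> AE \<omega> in M. \<phi> t \<omega> ` A \<omega> = A (\<theta> t \<omega>)"
  using A_invariant by (simp add: phi_invariant_def)

text \<open>The slack between \<open>r\<close> and \<open>s\<close> converts the closed ball, whose containment event is measurable,
  into the open ball of swift transitivity.\<close>
lemma swift_step:
  assumes "swift_transitive M \<phi>" "0 \<le> r" "r < s"
    and pos: "0 < prob {\<omega> \<in> space M. A \<omega> \<subseteq> cball x r}"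
  shows "0 < prob {\<omega> \<in> space M. A \<omega> \<subseteq> cball y (2 * s)}"
proof -
  obtain t where t: "0 < t"
    and pos': "0 < prob {\<omega> \<in> space M. \<phi> t \<omega> ` ball x s \<subseteq> cball y (2 * s)}"
    using swift_transitive_cball[OF assms(1), of s x y] assms(2,3) by auto
  have "0 < prob {\<omega> \<in> space M. A \<omega> \<subseteq> cball x r} *
      prob {\<omega> \<in> space M. \<phi> t \<omega> ` ball x s \<subseteq> cball y (2 * s)}"
    using pos pos' by simp
  also have "\<dots> \<le> prob {\<omega> \<in> space M. A \<omega> \<subseteq> cball y (2 * s)}"
  proof (rule prob_mult_le_of_shift[where t = t])
    have sub: "cball x r \<subseteq> ball x s" using assms(3) by auto
    show "AE \<omega> in M. \<omega> \<in> {\<omega> \<in> space M. A \<omega> \<subseteq> cball x r} \<longrightarrow>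
        \<omega> \<in> {\<omega> \<in> space M. \<phi> t \<omega> ` ball x s \<subseteq> cball y (2 * s)} \<longrightarrow>
        \<theta> t \<omega> \<in> {\<omega> \<in> space M. A \<omega> \<subseteq> cball y (2 * s)}"
      using A_image[OF less_imp_le[OF t]]
    proof eventually_elim
      case (elim \<omega>)
      show ?case
      proof (intro impI)
        assume *: "\<omega> \<in> {\<omega> \<in> space M. A \<omega> \<subseteq> cball x r}"
          "\<omega> \<in> {\<omega> \<in> space M. \<phi> t \<omega> ` ball x s \<subseteq> cball y (2 * s)}"
        then have "\<phi> t \<omega> ` A \<omega> \<subseteq> cball y (2 * s)" using sub by blast
        with * elim show "\<theta> t \<omega> \<in> {\<omega> \<in> space M. A \<omega> \<subseteq> cball y (2 * s)}"
          using theta_in_space by simp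
      qed
    qed
  qed (use t assms(2,3) in \<open>auto intro!: image_subset_closed_event A_subset_past A_subset_event\<close>)
  finally show ?thesis .
qed

text \<open>A set of diameter at most \<open>c\<close> lies in a ball of radius \<open>r > c\<close> around some point of a
  countable dense set; one of these countably many centres must occur with positive probability.\<close>
lemma ball_of_small_ediam:
  assumes "0 \<le> c" "c < r" and pos: "0 < prob {\<omega> \<in> space M. ediam (A \<omega>) \<le> ennreal c}"
  shows "\<exists>x. 0 < prob {\<omega> \<in> space M. A \<omega> \<subseteq> cball x r}"
proof (rule ccontr)
  assume "\<not> ?thesis"
  then have null: "prob {\<omega> \<in> space M. A \<omega> \<subseteq> cball x r} = 0" for x
    by (meson linorder_not_less measure_nonneg order_antisym)
  have ev: "{\<omega> \<in> space M. A \<omega> \<subseteq> cball x r} \<in> events" for x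
    using assms(1,2) by (intro A_subset_event) auto
  obtain D :: "'e set" where D: "countable D" "UNIV \<subseteq> closure D"
    by (rule separable[of UNIV]) auto
  have "AE \<omega> in M. \<forall>q\<in>D. \<omega> \<notin> {\<omega> \<in> space M. A \<omega> \<subseteq> cball q r}"
    using null prob_eq_0[OF ev] by (intro AE_ball_countable' D(1)) blast
  then have "AE \<omega> in M. \<not> ediam (A \<omega>) \<le> ennreal c"
    using AE_space
  proof eventually_elim
    case (elim \<omega>)
    obtain a where a: "a \<in> A \<omega>" using A_nonempty elim(2) by blast
    have "a \<in> closure D" using D(2) by auto
    then obtain q where q: "q \<in> D" "dist q a < r - c"
      unfolding closure_approachable using assms(2) by (metis diff_gt_0_iff_gt)
    have "\<not> A \<omega> \<subseteq> cball q r" using elim q by blast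
    then obtain b where b: "b \<in> A \<omega>" "r < dist q b" by (auto simp: subset_eq not_le)
    then have "c < dist a b" using q(2) dist_triangle[of q b a] by linarith
    then have "\<not> ennreal (dist a b) \<le> ennreal c" using assms(1) by simp
    then show ?case using a b(1) by (auto simp: ediam_le_iff)
  qed
  then have "prob {\<omega> \<in> space M. ediam (A \<omega>) \<le> ennreal c} = 0"
    by (subst prob_eq_0) auto
  with pos show False by simp
qed

text \<open>The constants leave room for each loss: \<open>r < 11/10 r\<close> before the transport, twice this is
  \<open>11/5 r < 12/5 r\<close>, contraction leaves a diameter of at most \<open>12/5 r / 4 = 3/5 r\<close>, and
  \<open>3/5 r < 3/4 r\<close> allows for the choice of a centre.\<close>
lemma contraction_step:
  assumes "swift_transitive M \<phi>" "contracting_on_large_sets M \<phi>" "0 < r"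
    and pos: "0 < prob {\<omega> \<in> space M. A \<omega> \<subseteq> cball x r}"
  shows "\<exists>y. 0 < prob {\<omega> \<in> space M. A \<omega> \<subseteq> cball y (3 / 4 * r)}"
proof -
  let ?R = "12 / 5 * r"
  have "0 < ?R" using assms(3) by simp
  then obtain y t where t: "0 < t"
    and pos': "0 < prob {\<omega> \<in> space M. ediam (\<phi> t \<omega> ` ball y ?R) \<le> ennreal (?R / 4)}"
    using assms(2) unfolding contracting_on_large_sets_def by blast
  let ?E = "{\<omega> \<in> space M. A \<omega> \<subseteq> cball y (2 * (11 / 10 * r))}"
  have "0 < prob ?E"
    using assms(3) by (intro swift_step[OF assms(1) _ _ pos]) auto
  then have "0 < prob ?E * prob {\<omega> \<in> space M. ediam (\<phi> t \<omega> ` ball y ?R) \<le> ennreal (?R / 4)}"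
    using pos' by simp
  also have "\<dots> \<le> prob {\<omega> \<in> space M. ediam (A \<omega>) \<le> ennreal (?R / 4)}"
  proof (rule prob_mult_le_of_shift[where t = t])
    show "{\<omega> \<in> space M. ediam (\<phi> t \<omega> ` ball y ?R) \<le> ennreal (?R / 4)} \<in> sets (\<F> 0 t)"
    proof -
      have [measurable]: "(\<lambda>\<omega>. ediam (\<phi> t \<omega> ` ball y ?R)) \<in> borel_measurable (\<F> 0 t)"
        using t by (intro ediam_image_measurable) simp
      have "{\<omega> \<in> space (\<F> 0 t). ediam (\<phi> t \<omega> ` ball y ?R) \<le> ennreal (?R / 4)} \<in> sets (\<F> 0 t)"
        by measurable
      then show ?thesis using t space_F by simp
    qed
    have sub: "cball y (2 * (11 / 10 * r)) \<subseteq> ball y ?R" using assms(3) by auto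
    show "AE \<omega> in M. \<omega> \<in> ?E \<longrightarrow>
        \<omega> \<in> {\<omega> \<in> space M. ediam (\<phi> t \<omega> ` ball y ?R) \<le> ennreal (?R / 4)} \<longrightarrow>
        \<theta> t \<omega> \<in> {\<omega> \<in> space M. ediam (A \<omega>) \<le> ennreal (?R / 4)}"
      using A_image[OF less_imp_le[OF t]]
    proof eventually_elim
      case (elim \<omega>)
      show ?case
      proof (intro impI)
        assume *: "\<omega> \<in> ?E" "\<omega> \<in> {\<omega> \<in> space M. ediam (\<phi> t \<omega> ` ball y ?R) \<le> ennreal (?R / 4)}"
        then have "A (\<theta> t \<omega>) \<subseteq> \<phi> t \<omega> ` ball y ?R" using elim sub by blast
        from ediam_mono[OF this] * show "\<theta> t \<omega> \<in> {\<omega> \<in> space M. ediam (A \<omega>) \<le> ennreal (?R / 4)}"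
          using theta_in_space by auto
      qed
    qed
  qed (use t assms(3) A_subset_past in auto)
  finally have small: "0 < prob {\<omega> \<in> space M. ediam (A \<omega>) \<le> ennreal (?R / 4)}" .
  show ?thesis
    by (rule ball_of_small_ediam[OF _ _ small]) (use assms(3) in auto)
qed

lemma contraction_iterate:
  assumes "swift_transitive M \<phi>" "contracting_on_large_sets M \<phi>" "0 < r"
    and pos: "0 < prob {\<omega> \<in> space M. A \<omega> \<subseteq> cball x r}"
  shows "\<exists>y. 0 < prob {\<omega> \<in> space M. A \<omega> \<subseteq> cball y ((3 / 4) ^ n * r)}"
proof (induction n)
  case 0
  then show ?case using pos by auto
next
  case (Suc n)
  then obtain y where "0 < prob {\<omega> \<in> space M. A \<omega> \<subseteq> cball y ((3 / 4) ^ n * r)}" by blast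
  from contraction_step[OF assms(1,2) _ this] assms(3) show ?case
    by (simp add: mult.assoc)
qed

lemma contracting_imp_small_diameter:
  assumes "swift_transitive M \<phi>" "contracting_on_large_sets M \<phi>"
    and "AE \<omega> in M. bounded (A \<omega>)"
  shows "small_diameter M A"
  unfolding small_diameter_def
proof (intro allI impI)
  fix \<epsilon> :: real assume "0 < \<epsilon>"
  obtain x :: 'e where True by blast
  have "\<exists>k\<in>UNIV. 0 < prob {\<omega> \<in> space M. A \<omega> \<subseteq> cball x (real (Suc k))}"
  proof (rule countable_cover_positive)
    show "AE \<omega> in M. \<exists>k\<in>UNIV. \<omega> \<in> {\<omega> \<in> space M. A \<omega> \<subseteq> cball x (real (Suc k))}"
      using assms(3) AE_space
    proof eventually_elim
      case (elim \<omega>)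
      then obtain R where R: "\<forall>a\<in>A \<omega>. dist x a \<le> R" using bounded_any_center[of _ x] by blast
      obtain k where "R \<le> real k" using real_arch_simple by blast
      then have "A \<omega> \<subseteq> cball x (real (Suc k))" using R by force
      then show ?case using elim by blast
    qed
  qed (auto intro!: A_subset_event)
  then obtain k where k: "0 < prob {\<omega> \<in> space M. A \<omega> \<subseteq> cball x (real (Suc k))}" by blast
  obtain n where n: "(3 / 4 :: real) ^ n < \<epsilon> / (2 * real (Suc k))"
    using real_arch_pow_inv[of "\<epsilon> / (2 * real (Suc k))" "3 / 4"] \<open>0 < \<epsilon>\<close> by auto
  let ?r = "(3 / 4) ^ n * real (Suc k)"
  obtain y where y: "0 < prob {\<omega> \<in> space M. A \<omega> \<subseteq> cball y ?r}"
    using contraction_iterate[OF assms(1,2) _ k] by auto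
  have "2 * ?r < \<epsilon>" using n by (simp add: field_simps)
  then have lt: "ennreal (2 * ?r) < ennreal \<epsilon>"
    using \<open>0 < \<epsilon>\<close> by (intro ennreal_lessI)
  have "ediam (A \<omega>) < ennreal \<epsilon>" if "A \<omega> \<subseteq> cball y ?r" for \<omega>
  proof -
    have "ediam (A \<omega>) \<le> ennreal (2 * ?r)"
      by (rule order_trans[OF ediam_mono[OF that] ediam_cball_le]) simp
    then show ?thesis using lt by (rule le_less_trans)
  qed
  then have "prob {\<omega> \<in> space M. A \<omega> \<subseteq> cball y ?r} \<le> prob {\<omega> \<in> space M. ediam (A \<omega>) < ennreal \<epsilon>}"
    by (intro finite_measure_mono) auto
  with y show "0 < prob {\<omega> \<in> space M. ediam (A \<omega>) < ennreal \<epsilon>}" by linarith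
qed

lemma small_diameter_imp_subset_open:
  assumes "swift_transitive M \<phi>" "small_diameter M A" "open U" "U \<noteq> {}"
  shows "\<exists>C. closed C \<and> C \<noteq> {} \<and> C \<subseteq> U \<and> 0 < prob {\<omega> \<in> space M. A \<omega> \<subseteq> C}"
proof -
  obtain y where "y \<in> U" using assms(4) by blast
  then obtain \<delta> where y: "0 < \<delta>" "cball y \<delta> \<subseteq> U"
    using assms(3) open_contains_cball by blast
  have "0 < prob {\<omega> \<in> space M. ediam (A \<omega>) < ennreal (\<delta> / 8)}"
    using assms(2) y(1) by (simp add: small_diameter_def)
  also have "\<dots> \<le> prob {\<omega> \<in> space M. ediam (A \<omega>) \<le> ennreal (\<delta> / 8)}"
    by (intro finite_measure_mono) auto
  finally obtain x where x: "0 < prob {\<omega> \<in> space M. A \<omega> \<subseteq> cball x (\<delta> / 4)}"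
    using ball_of_small_ediam[of "\<delta> / 8" "\<delta> / 4"] y(1) by auto
  have "0 < prob {\<omega> \<in> space M. A \<omega> \<subseteq> cball y (2 * (\<delta> / 2))}"
    using y(1) by (intro swift_step[OF assms(1) _ _ x]) auto
  then show ?thesis
    using y by (intro exI[of _ "cball y \<delta>"]) auto
qed

text \<open>The lower bound for the probability of a diameter at most \<open>\<epsilon>\<close> does not depend on \<open>\<epsilon>\<close>, so it
  survives the decreasing limit \<open>\<epsilon> \<rightarrow> 0\<close>.\<close>
lemma singleton_positive:
  assumes "swift_transitive M \<phi>" "small_diameter M A"
    and "open U" "U \<noteq> {}" "asymptotically_stable_on M \<phi> U"
  shows "0 < prob {\<omega> \<in> space M. ediam (A \<omega>) = 0}"
proof -
  obtain C where C: "closed C" "C \<noteq> {}" "C \<subseteq> U"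
    and posC: "0 < prob {\<omega> \<in> space M. A \<omega> \<subseteq> C}" (is "0 < prob ?E")
    using small_diameter_imp_subset_open[OF assms(1-4)] by blast
  obtain p where p: "0 < p"
    "\<And>\<epsilon>. 0 < \<epsilon> \<Longrightarrow> \<exists>t\<ge>0. p \<le> prob {\<omega> \<in> space M. ediam (\<phi> t \<omega> ` U) \<le> ennreal \<epsilon>}"
    using stable_uniform_contraction[OF assms(5)] by blast
  have uniform: "prob ?E * p \<le> prob {\<omega> \<in> space M. ediam (A \<omega>) \<le> ennreal \<epsilon>}" if \<epsilon>: "0 < \<epsilon>" for \<epsilon>
  proof -
    obtain t where t: "0 \<le> t" "p \<le> prob {\<omega> \<in> space M. ediam (\<phi> t \<omega> ` U) \<le> ennreal \<epsilon>}"
      (is "_ \<le> prob ?Y")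
      using p(2)[OF \<epsilon>] by blast
    have "prob ?E * p \<le> prob ?E * prob ?Y"
      using t(2) by (intro mult_left_mono) auto
    also have "\<dots> \<le> prob {\<omega> \<in> space M. ediam (A \<omega>) \<le> ennreal \<epsilon>}"
    proof (rule prob_mult_le_of_shift[OF t(1)])
      have [measurable]: "(\<lambda>\<omega>. ediam (\<phi> t \<omega> ` U)) \<in> borel_measurable (\<F> 0 t)"
        by (rule ediam_image_measurable[OF t(1)])
      have "{\<omega> \<in> space (\<F> 0 t). ediam (\<phi> t \<omega> ` U) \<le> ennreal \<epsilon>} \<in> sets (\<F> 0 t)"
        by measurable
      then show "?Y \<in> sets (\<F> 0 t)" using t(1) space_F by simp
      show "AE \<omega> in M. \<omega> \<in> ?E \<longrightarrow> \<omega> \<in> ?Y \<longrightarrow>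
          \<theta> t \<omega> \<in> {\<omega> \<in> space M. ediam (A \<omega>) \<le> ennreal \<epsilon>}"
        using A_image[OF t(1)]
      proof eventually_elim
        case (elim \<omega>)
        show ?case
        proof (intro impI)
          assume *: "\<omega> \<in> ?E" "\<omega> \<in> ?Y"
          then have "A (\<theta> t \<omega>) \<subseteq> \<phi> t \<omega> ` U" using elim C(3) by blast
          from ediam_mono[OF this] * show "\<theta> t \<omega> \<in> {\<omega> \<in> space M. ediam (A \<omega>) \<le> ennreal \<epsilon>}"
            using theta_in_space by auto
        qed
      qed
    qed (use C A_subset_past in auto)
    finally show ?thesis .
  qed
  let ?D = "\<lambda>n. {\<omega> \<in> space M. ediam (A \<omega>) \<le> ennreal (1 / Suc n)}"
  have eq: "(\<Inter>n. ?D n) = {\<omega> \<in> space M. ediam (A \<omega>) = 0}"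
  proof (intro equalityI subsetI)
    fix \<omega> assume \<omega>: "\<omega> \<in> (\<Inter>n. ?D n)"
    have "(\<lambda>n. ennreal (1 / Suc n)) \<longlonglongrightarrow> ennreal 0"
      by (intro tendsto_ennrealI LIMSEQ_Suc[OF lim_1_over_n])
    then have "ediam (A \<omega>) \<le> ennreal 0"
      by (rule LIMSEQ_le_const) (use \<omega> in auto)
    with \<omega> show "\<omega> \<in> {\<omega> \<in> space M. ediam (A \<omega>) = 0}" by auto
  qed auto
  have "decseq ?D"
  proof (rule decseq_SucI)
    fix n
    have "ennreal (1 / Suc (Suc n)) \<le> ennreal (1 / Suc n)"
      by (intro ennreal_leI frac_le) auto
    then show "?D (Suc n) \<subseteq> ?D n"
      using order_trans by blast
  qed
  then have "(\<lambda>n. prob (?D n)) \<longlonglongrightarrow> prob (\<Inter>n. ?D n)"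
    by (intro finite_Lim_measure_decseq) auto
  then have "prob ?E * p \<le> prob (\<Inter>n. ?D n)"
    by (rule LIMSEQ_le_const) (use uniform in auto)
  moreover have "0 < prob ?E * p" using posC p(1) by simp
  ultimately show ?thesis unfolding eq by linarith
qed

lemma stable_imp_singleton:
  assumes "swift_transitive M \<phi>" "small_diameter M A"
    and "open U" "U \<noteq> {}" "asymptotically_stable_on M \<phi> U"
  shows "AE \<omega> in M. is_singleton (A \<omega>)"
proof -
  let ?S = "{\<omega> \<in> space M. ediam (A \<omega>) = 0}"
  have "{\<omega> \<in> space past_mod_null. ediam (A \<omega>) = 0} \<in> sets past_mod_null"
    using A_ediam_past by measurable
  then have S: "?S \<in> sets past_mod_null" by simp
  have "prob ?S = 0 \<or> prob ?S = 1"
  proof (rule zero_one_law[OF S])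
    fix t :: real assume "0 \<le> t"
    show "AE \<omega> in M. \<omega> \<in> ?S \<longrightarrow> \<theta> t \<omega> \<in> ?S"
      using A_image[OF \<open>0 \<le> t\<close>] AE_space
    proof eventually_elim
      case (elim \<omega>)
      show ?case
      proof
        assume "\<omega> \<in> ?S"
        then have "is_singleton (\<phi> t \<omega> ` A \<omega>)"
          using is_singleton_iff_ediam[OF A_nonempty[OF elim(2)]] by (auto simp: is_singleton_def)
        then show "\<theta> t \<omega> \<in> ?S"
          using is_singleton_iff_ediam[OF A_nonempty] theta_in_space[OF elim(2)] elim(1) by auto
      qed
    qed
  qed
  then have "prob ?S = 1"
    using singleton_positive[OF assms] by auto
  then have "AE \<omega> in M. \<omega> \<in> ?S"
    by (rule AE_prob_1)
  then show ?thesis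
    using AE_space by eventually_elim (auto simp: is_singleton_iff_ediam A_nonempty)
qed

end

section \<open>Weak attractors are determined by the past\<close>

text \<open>The analogue for random compact sets of the tightness of a single measure. For each \<open>k\<close>, a
  compact value is covered by finitely many of the balls of radius \<open>1 / (k + 1)\<close> around a dense
  sequence, so the first \<open>n\<^sub>k\<close> of them suffice up to probability \<open>\<epsilon> / 2\<^sup>k\<^sup>+\<^sup>1\<close>. The intersection of
  these finite unions is closed and totally bounded, hence compact.\<close>
lemma (in prob_space) random_compact_set_tight:
  fixes A :: "'a \<Rightarrow> 'e::polish_space set"
  assumes A: "random_compact_set M A" and "0 < \<epsilon>"
  shows "\<exists>K. compact K \<and> K \<noteq> {} \<and> {\<omega> \<in> space M. A \<omega> \<subseteq> K} \<in> events \<and>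
    prob {\<omega> \<in> space M. \<not> A \<omega> \<subseteq> K} \<le> \<epsilon>"
proof -
  have ne: "\<And>\<omega>. \<omega> \<in> space M \<Longrightarrow> A \<omega> \<noteq> {}"
    and cpt: "AE \<omega> in M. compact (A \<omega>)"
    and meas: "\<And>x. (\<lambda>\<omega>. infdist x (A \<omega>)) \<in> borel_measurable M"
    using A by (auto simp: random_compact_set_def)
  have ev: "{\<omega> \<in> space M. A \<omega> \<subseteq> C} \<in> events" if "closed C" "C \<noteq> {}" for C
    using subset_closed_event[of M A C] ne meas that by simp
  have evc: "{\<omega> \<in> space M. \<not> A \<omega> \<subseteq> C} \<in> events" if "closed C" "C \<noteq> {}" for C
    using sets.sets_Collect_neg[OF ev[OF that]] .
  obtain D :: "'e set" where D: "countable D" "UNIV \<subseteq> closure D"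
    by (rule separable[of UNIV]) auto
  then have "D \<noteq> {}" by auto
  define q where "q = from_nat_into D"
  have q: "range q = D"
    unfolding q_def using \<open>D \<noteq> {}\<close> D(1) by (rule range_from_nat_into)
  define C where "C k n = (\<Union>i\<le>n. cball (q i) (1 / Suc k))" for k n :: nat
  have "q 0 \<in> C k n" for k n
    unfolding C_def by (rule UN_I[of 0]) auto
  moreover have "closed (C k n)" for k n
    unfolding C_def by (intro closed_UN) auto
  ultimately have C: "closed (C k n)" "C k n \<noteq> {}" for k n
    by blast+
  have "\<exists>n. prob {\<omega> \<in> space M. \<not> A \<omega> \<subseteq> C k n} < \<epsilon> * (1 / 2) ^ Suc k" for k
  proof -
    let ?B = "\<lambda>n. {\<omega> \<in> space M. \<not> A \<omega> \<subseteq> C k n}"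
    have "decseq ?B"
    proof (rule decseq_SucI)
      fix n
      have "C k n \<subseteq> C k (Suc n)" unfolding C_def by (intro UN_mono) auto
      then show "?B (Suc n) \<subseteq> ?B n" by auto
    qed
    then have "(\<lambda>n. prob (?B n)) \<longlonglongrightarrow> prob (\<Inter>n. ?B n)"
      using evc[OF C] by (intro finite_Lim_measure_decseq) auto
    also have "prob (\<Inter>n. ?B n) = 0"
    proof (subst prob_eq_0)
      show "(\<Inter>n. ?B n) \<in> events" using evc[OF C] by (intro sets.countable_INT) auto
      show "AE \<omega> in M. \<omega> \<notin> (\<Inter>n. ?B n)"
        using cpt
      proof eventually_elim
        case (elim \<omega>)
        have cover: "A \<omega> \<subseteq> (\<Union>i\<in>UNIV. ball (q i) (1 / Suc k))"
        proof
          fix a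
          have "a \<in> closure D" "0 < 1 / real (Suc k)" using D(2) by auto
          then obtain d where "d \<in> D" "dist d a < 1 / Suc k"
            using closure_approachable[of a D] by blast
          then show "a \<in> (\<Union>i\<in>UNIV. ball (q i) (1 / Suc k))"
            using q by auto
        qed
        obtain I where I: "finite I" "A \<omega> \<subseteq> (\<Union>i\<in>I. ball (q i) (1 / Suc k))"
          by (rule compactE_image[OF elim _ cover]) (auto intro: that)
        have "I \<subseteq> {..Max I}" using I(1) by auto
        then have "(\<Union>i\<in>I. ball (q i) (1 / Suc k)) \<subseteq> C k (Max I)"
          unfolding C_def by (intro UN_mono ball_subset_cball)
        with I(2) have "A \<omega> \<subseteq> C k (Max I)" by (rule subset_trans)
        then show ?case by auto
      qed
    qed
    finally have "eventually (\<lambda>n. prob (?B n) < \<epsilon> * (1 / 2) ^ Suc k) sequentially"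
      by (rule order_tendstoD) (use \<open>0 < \<epsilon>\<close> in simp)
    then show ?thesis by (auto simp: eventually_sequentially)
  qed
  then obtain n where n: "\<And>k. prob {\<omega> \<in> space M. \<not> A \<omega> \<subseteq> C k (n k)} < \<epsilon> * (1 / 2) ^ Suc k"
    by metis
  \<comment> \<open>The extra point keeps \<open>K\<close> non-empty even when \<open>\<epsilon>\<close> is too large to force this.\<close>
  define K where "K = insert (q 0) (\<Inter>k. C k (n k))"
  have "closed K"
    unfolding K_def using C(1) by (intro closed_insert closed_INT) auto
  have "compact K"
    unfolding compact_eq_totally_bounded
  proof (intro conjI allI impI)
    show "Topological_Spaces.complete K" using \<open>closed K\<close> by (simp add: complete_eq_closed)
    fix e :: real assume "0 < e"
    then obtain k where k: "1 / real (Suc k) < e" by (rule nat_approx_posE)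
    have "K \<subseteq> (\<Union>x\<in>q ` {..n k}. ball x e)"
    proof
      fix z assume "z \<in> K"
      then consider "z = q 0" | "z \<in> C k (n k)" unfolding K_def by auto
      then show "z \<in> (\<Union>x\<in>q ` {..n k}. ball x e)"
      proof cases
        case 2
        then obtain i where "i \<le> n k" "dist (q i) z \<le> 1 / Suc k" unfolding C_def by auto
        then have "dist (q i) z < e" using k by linarith
        then show ?thesis using \<open>i \<le> n k\<close> by auto
      qed (use \<open>0 < e\<close> in \<open>auto intro!: bexI[of _ 0]\<close>)
    qed
    then show "\<exists>k. finite k \<and> K \<subseteq> (\<Union>x\<in>k. ball x e)" by blast
  qed
  let ?B = "\<lambda>k. {\<omega> \<in> space M. \<not> A \<omega> \<subseteq> C k (n k)}"
  have sums: "(\<lambda>k. \<epsilon> * (1 / 2) ^ Suc k) sums (\<epsilon> * 1)"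
    by (intro sums_mult power_half_series)
  have sm: "summable (\<lambda>k. prob (?B k))"
    by (rule summable_comparison_test'[OF sums_summable[OF sums], of 0])
       (use n in \<open>auto intro: less_imp_le\<close>)
  have "prob {\<omega> \<in> space M. \<not> A \<omega> \<subseteq> K} \<le> prob (\<Union>k. ?B k)"
  proof (rule finite_measure_mono)
    show "{\<omega> \<in> space M. \<not> A \<omega> \<subseteq> K} \<subseteq> (\<Union>k. ?B k)"
      unfolding K_def by blast
  qed (use evc[OF C] in auto)
  also have "\<dots> \<le> (\<Sum>k. prob (?B k))"
    using evc[OF C] by (intro finite_measure_subadditive_countably sm) auto
  also have "\<dots> \<le> (\<Sum>k. \<epsilon> * (1 / 2) ^ Suc k)"
    using n by (intro suminf_le sm sums_summable[OF sums] less_imp_le) auto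
  also have "\<dots> = \<epsilon>" using sums_unique[OF sums] by simp
  finally show ?thesis
    using \<open>compact K\<close> ev[OF \<open>closed K\<close>] by (intro exI[of _ K]) (auto simp: K_def)
qed

lemma weak_attractor_random_compact: "weak_attractor M \<theta> \<phi> A \<Longrightarrow> random_compact_set M A"
  unfolding weak_attractor_def by (rule conjunct1)

lemma weak_attractor_invariant: "weak_attractor M \<theta> \<phi> A \<Longrightarrow> phi_invariant M \<theta> \<phi> A"
  unfolding weak_attractor_def by (elim conjE)

lemma weak_attractor_attracts:
  assumes "weak_attractor M \<theta> \<phi> A" "compact K" "0 < \<epsilon>"
  shows "((\<lambda>t. measure M {\<omega>\<in>space M.
      (SUP x\<in>K. ennreal (infdist (\<phi> t (\<theta> (- t) \<omega>) x) (A \<omega>))) > ennreal \<epsilon>}) \<longlongrightarrow> 0) at_top"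
proof -
  have "\<forall>B. compact B \<longrightarrow> (\<forall>\<epsilon>>0. ((\<lambda>t. measure M {\<omega>\<in>space M.
      (SUP x\<in>B. ennreal (infdist (\<phi> t (\<theta> (- t) \<omega>) x) (A \<omega>))) > ennreal \<epsilon>}) \<longlongrightarrow> 0) at_top)"
    using assms(1) unfolding weak_attractor_def by (elim conjE)
  from this[rule_format, OF assms(2,3)] show ?thesis .
qed

context white_noise_rds
begin

lemma pullback_image_invariant:
  assumes "phi_invariant M \<theta> \<phi> A" "0 \<le> t"
  shows "AE \<omega> in M. \<phi> t (\<theta> (- t) \<omega>) ` A (\<theta> (- t) \<omega>) = A \<omega>"
proof -
  have "AE \<omega> in M. \<phi> t \<omega> ` A \<omega> = A (\<theta> t \<omega>)"
    using assms by (simp add: phi_invariant_def)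
  from AE_theta[OF this, of "- t"] AE_space show ?thesis
  proof eventually_elim
    case (elim \<omega>)
    have "\<theta> t (\<theta> (- t) \<omega>) = \<omega>"
      using theta_add[OF elim(2), of t "- t"] theta_zero[OF elim(2)] by simp
    with elim(1) show ?case by simp
  qed
qed

text \<open>\<open>Z\<close> is the distance to the image of a deterministic compact \<open>K\<close> under the flow started at a
  large negative time \<open>-t\<close>. It can be far from the distance to \<open>A\<close> only if \<open>A\<close> was not contained in
  \<open>K\<close> at time \<open>-t\<close>, or if \<open>K\<close> has not yet been attracted; each of these has probability at most
  \<open>\<epsilon> / 2\<close>.\<close>
lemma past_approximation:
  assumes att: "weak_attractor M \<theta> \<phi> A" and "0 < \<epsilon>"
  shows "\<exists>Z B. Z \<in> borel_measurable (past_algebra M \<F>) \<and> B \<in> events \<and> prob B \<le> \<epsilon> \<and>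
    (AE \<omega> in M. \<omega> \<notin> B \<longrightarrow> \<bar>Z \<omega> - infdist x (A \<omega>)\<bar> \<le> \<epsilon>)"
proof -
  have cpt: "random_compact_set M A"
    by (rule weak_attractor_random_compact[OF att])
  have ne: "\<And>\<omega>. \<omega> \<in> space M \<Longrightarrow> A \<omega> \<noteq> {}"
    and meas: "\<And>x. (\<lambda>\<omega>. infdist x (A \<omega>)) \<in> borel_measurable M"
    using cpt by (auto simp: random_compact_set_def)
  obtain K where K: "compact K" "K \<noteq> {}" and evK: "{\<omega> \<in> space M. A \<omega> \<subseteq> K} \<in> events"
    and probK: "prob {\<omega> \<in> space M. \<not> A \<omega> \<subseteq> K} \<le> \<epsilon> / 2"
    using random_compact_set_tight[OF cpt, of "\<epsilon> / 2"] \<open>0 < \<epsilon>\<close> by auto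
  obtain T where T: "countable T" "T \<subseteq> K" "K \<subseteq> closure T" by (rule separable)
  then have "T \<noteq> {}" using K(2) by auto
  define far where
    "far t = {\<omega>\<in>space M. (SUP x\<in>K. ennreal (infdist (\<phi> t (\<theta> (- t) \<omega>) x) (A \<omega>))) > ennreal \<epsilon>}" for t
  have "eventually (\<lambda>t. prob (far t) < \<epsilon> / 2) at_top"
    using weak_attractor_attracts[OF att K(1) \<open>0 < \<epsilon>\<close>] \<open>0 < \<epsilon>\<close>
    unfolding far_def by (intro order_tendstoD(2)[where y = 0]) auto
  then have "eventually (\<lambda>t. prob (far t) < \<epsilon> / 2 \<and> 0 \<le> t) at_top"
    by (intro eventually_conj eventually_ge_at_top)
  then obtain t where t: "prob (far t) < \<epsilon> / 2" "0 \<le> t"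
    by (auto simp: eventually_at_top_linorder)
  define \<psi> where "\<psi> \<omega> = \<phi> t (\<theta> (- t) \<omega>)" for \<omega>
  have cont: "continuous_on UNIV (\<psi> \<omega>)" if "\<omega> \<in> space M" for \<omega>
    unfolding \<psi>_def using that t(2) by (intro phi_continuous theta_in_space)
  have past: "(\<lambda>\<omega>. \<psi> \<omega> y) \<in> borel_measurable (past_algebra M \<F>)" for y
  proof (rule measurable_from_subalg)
    show "subalgebra (past_algebra M \<F>) (\<F> (- t) 0)"
      using F_subset_past[of "- t"] space_F[of "- t" 0] t(2) by (simp add: subalgebra_def)
    show "(\<lambda>\<omega>. \<psi> \<omega> y) \<in> borel_measurable (\<F> (- t) 0)"
      unfolding \<psi>_def by (rule phi_pullback_measurable[OF t(2)])
  qed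
  have psi_meas: "(\<lambda>\<omega>. \<psi> \<omega> y) \<in> borel_measurable M" for y
    by (rule measurable_from_subalg[OF _ past]) (simp add: subalgebra_def past_subset)
  have far_eq: "far t = {\<omega> \<in> space M. \<exists>y\<in>T. \<epsilon> < infdist (\<psi> \<omega> y) (A \<omega>)}"
  proof -
    have "(\<exists>y\<in>K. \<epsilon> < infdist (\<psi> \<omega> y) (A \<omega>)) \<longleftrightarrow> (\<exists>y\<in>T. \<epsilon> < infdist (\<psi> \<omega> y) (A \<omega>))"
      if "\<omega> \<in> space M" for \<omega>
    proof -
      let ?V = "{y. \<epsilon> < infdist (\<psi> \<omega> y) (A \<omega>)}"
      have "open ?V"
        by (intro open_Collect_less continuous_on_const continuous_on_infdist cont[OF that])
      then have "?V \<inter> closure T = {} \<longleftrightarrow> ?V \<inter> T = {}"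
        by (rule open_Int_closure_eq_empty)
      then show ?thesis using T(2,3) by blast
    qed
    then show ?thesis
      using \<open>0 < \<epsilon>\<close> unfolding far_def \<psi>_def by (auto simp: less_SUP_iff ennreal_less_iff)
  qed
  have far_event: "far t \<in> events"
    unfolding far_eq
    using infdist_measurable_compose[of M A, OF ne meas psi_meas]
    by (intro sets.sets_Collect_countable_Ex'[OF _ T(1)]) measurable
  let ?N = "{\<omega> \<in> space M. \<not> A \<omega> \<subseteq> K}"
  have evN: "?N \<in> events" by (rule sets.sets_Collect_neg[OF evK])
  define B where "B = \<theta> (- t) -` ?N \<inter> space M \<union> far t"
  have evB: "\<theta> (- t) -` ?N \<inter> space M \<in> events" using evN by measurable
  have "prob B \<le> prob (\<theta> (- t) -` ?N \<inter> space M) + prob (far t)"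
    unfolding B_def using evB far_event by (rule measure_Un_le)
  also have "\<dots> \<le> \<epsilon>"
    using prob_theta_vimage[OF evN, of "- t"] probK t(1) by simp
  finally have "prob B \<le> \<epsilon>" .
  moreover have "AE \<omega> in M. \<omega> \<notin> B \<longrightarrow> \<bar>infdist x (\<psi> \<omega> ` T) - infdist x (A \<omega>)\<bar> \<le> \<epsilon>"
    using pullback_image_invariant[OF weak_attractor_invariant[OF att] t(2)] AE_space
  proof eventually_elim
    case (elim \<omega>)
    show ?case
    proof
      assume nB: "\<omega> \<notin> B"
      show "\<bar>infdist x (\<psi> \<omega> ` T) - infdist x (A \<omega>)\<bar> \<le> \<epsilon>"
      proof (rule infdist_image_near[OF ne[OF elim(2)] _ T(2,3) cont[OF elim(2)]])
        have "A (\<theta> (- t) \<omega>) \<subseteq> K"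
          using nB elim(2) theta_in_space[OF elim(2)] by (auto simp: B_def)
        then have "\<psi> \<omega> ` A (\<theta> (- t) \<omega>) \<subseteq> \<psi> \<omega> ` K" by (rule image_mono)
        then show "A \<omega> \<subseteq> \<psi> \<omega> ` K"
          using elim(1) by (simp add: \<psi>_def)
        fix y assume "y \<in> K"
        have "\<omega> \<notin> far t" using nB by (simp add: B_def)
        then have "(SUP x\<in>K. ennreal (infdist (\<psi> \<omega> x) (A \<omega>))) \<le> ennreal \<epsilon>"
          using elim(2) by (simp add: far_def \<psi>_def not_less)
        then show "infdist (\<psi> \<omega> y) (A \<omega>) \<le> \<epsilon>"
          using \<open>y \<in> K\<close> \<open>0 < \<epsilon>\<close> by (simp add: SUP_le_iff)
      qed
    qed
  qed
  moreover have "(\<lambda>\<omega>. infdist x (\<psi> \<omega> ` T)) \<in> borel_measurable (past_algebra M \<F>)"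
  proof -
    have "(\<lambda>\<omega>. INF y\<in>T. dist x (\<psi> \<omega> y)) \<in> borel_measurable (past_algebra M \<F>)"
      using T(1) past by measurable
    then show ?thesis
      using \<open>T \<noteq> {}\<close> by (simp add: infdist_notempty image_image)
  qed
  moreover have "B \<in> events" unfolding B_def using evB far_event by (rule sets.Un)
  ultimately show ?thesis
    by (intro exI[of _ "\<lambda>\<omega>. infdist x (\<psi> \<omega> ` T)"] exI[of _ B] conjI)
qed

text \<open>With summable errors the approximations of the previous lemma converge almost surely, by
  Borel--Cantelli.\<close>
lemma weak_attractor_past:
  assumes att: "weak_attractor M \<theta> \<phi> A"
  shows "(\<lambda>\<omega>. infdist x (A \<omega>)) \<in> borel_measurable past_mod_null"
proof -
  have meas: "(\<lambda>\<omega>. infdist x (A \<omega>)) \<in> borel_measurable M"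
    using weak_attractor_random_compact[OF att] by (simp add: random_compact_set_def)
  have "\<forall>n. \<exists>Z B. Z \<in> borel_measurable (past_algebra M \<F>) \<and> B \<in> events \<and> prob B \<le> (1 / 2) ^ n \<and>
      (AE \<omega> in M. \<omega> \<notin> B \<longrightarrow> \<bar>Z \<omega> - infdist x (A \<omega>)\<bar> \<le> (1 / 2) ^ n)"
    by (intro allI past_approximation[OF att]) simp
  from choice[OF this] obtain Z where "\<forall>n. \<exists>B. Z n \<in> borel_measurable (past_algebra M \<F>) \<and>
      B \<in> events \<and> prob B \<le> (1 / 2) ^ n \<and>
      (AE \<omega> in M. \<omega> \<notin> B \<longrightarrow> \<bar>Z n \<omega> - infdist x (A \<omega>)\<bar> \<le> (1 / 2) ^ n)" ..
  from choice[OF this] obtain B where ZB: "\<forall>n. Z n \<in> borel_measurable (past_algebra M \<F>) \<and>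
      B n \<in> events \<and> prob (B n) \<le> (1 / 2) ^ n \<and>
      (AE \<omega> in M. \<omega> \<notin> B n \<longrightarrow> \<bar>Z n \<omega> - infdist x (A \<omega>)\<bar> \<le> (1 / 2) ^ n)" ..
  have Z: "Z n \<in> borel_measurable (past_algebra M \<F>)"
    and B: "B n \<in> events" "prob (B n) \<le> (1 / 2) ^ n"
    and near: "AE \<omega> in M. \<omega> \<notin> B n \<longrightarrow> \<bar>Z n \<omega> - infdist x (A \<omega>)\<bar> \<le> (1 / 2) ^ n" for n
    using spec[OF ZB, of n] by (simp_all only:)
  have "summable (\<lambda>n. prob (B n))"
    by (rule summable_comparison_test'[OF summable_geometric[of "1 / 2"], of 0]) (use B(2) in auto)
  then have "AE \<omega> in M. eventually (\<lambda>n. \<omega> \<in> space M - B n) sequentially"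
    using B(1) by (intro borel_cantelli_AE1) (simp_all add: emeasure_eq_measure)
  moreover have "AE \<omega> in M. \<forall>n. \<omega> \<notin> B n \<longrightarrow> \<bar>Z n \<omega> - infdist x (A \<omega>)\<bar> \<le> (1 / 2) ^ n"
    using near by (simp add: AE_all_countable)
  ultimately have "AE \<omega> in M. infdist x (A \<omega>) = lim (\<lambda>n. Z n \<omega>)"
  proof eventually_elim
    case (elim \<omega>)
    have "(\<lambda>n. Z n \<omega> - infdist x (A \<omega>)) \<longlonglongrightarrow> 0"
    proof (rule Lim_null_comparison)
      show "eventually (\<lambda>n. norm (Z n \<omega> - infdist x (A \<omega>)) \<le> (1 / 2) ^ n) sequentially"
        using elim(1) by eventually_elim (use elim(2) in auto)
      show "(\<lambda>n. (1 / 2 :: real) ^ n) \<longlonglongrightarrow> 0" by (rule LIMSEQ_realpow_zero) auto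
    qed
    then have "(\<lambda>n. Z n \<omega>) \<longlonglongrightarrow> infdist x (A \<omega>)" by (rule LIM_zero_cancel)
    then show ?case by (rule limI[symmetric])
  qed
  then show ?thesis
    by (rule borel_measurable_past_mod_null_AE[OF meas borel_measurable_lim_metric[OF Z]])
qed

end

section \<open>Small diameter and synchronization\<close>

theorem theorem2p14:
  fixes M :: "'w measure" and \<theta> :: "real \<Rightarrow> 'w \<Rightarrow> 'w"
    and \<phi> :: "real \<Rightarrow> 'w \<Rightarrow> 'e::polish_space \<Rightarrow> 'e"
    and \<F> :: "real \<Rightarrow> real \<Rightarrow> 'w measure"
  assumes "white_noise_rds M \<theta> \<phi> \<F>"
    and "swift_transitive M \<phi>"
  shows "(contracting_on_large_sets M \<phi> \<longrightarrow>
           (\<forall>A. random_compact_set M A \<and> set_measurable_wrt (past_algebra M \<F>) A \<and>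
                phi_invariant M \<theta> \<phi> A \<longrightarrow> small_diameter M A))
       \<and> (\<forall>U. open U \<and> U \<noteq> {} \<and> asymptotically_stable_on M \<phi> U \<longrightarrow>
           (\<forall>A. random_closed_set M A \<and> set_measurable_wrt (past_algebra M \<F>) A \<and>
                phi_invariant M \<theta> \<phi> A \<and> small_diameter M A
                \<longrightarrow> (AE \<omega> in M. is_singleton (A \<omega>)))
         \<and> ((\<exists>A. weak_attractor M \<theta> \<phi> A \<and> small_diameter M A) \<longrightarrow> synchronization M \<theta> \<phi>))"
proof -
  interpret white_noise_rds M \<theta> \<phi> \<F> by (rule assms(1))
  have invariant_set: "invariant_random_set M \<theta> \<phi> \<F> A"
    if "\<forall>\<omega>\<in>space M. A \<omega> \<noteq> {}" "set_measurable_wrt (past_algebra M \<F>) A"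
      "phi_invariant M \<theta> \<phi> A" for A
  proof unfold_locales
    show "(\<lambda>\<omega>. infdist x (A \<omega>)) \<in> borel_measurable past_mod_null" for x
      using that(2) unfolding set_measurable_wrt_def by (intro borel_measurable_past_mod_null) blast
  qed (use that(1,3) in auto)
  show ?thesis
  proof (intro conjI allI impI)
    fix A :: "'w \<Rightarrow> 'e set"
    assume contr: "contracting_on_large_sets M \<phi>"
      and A: "random_compact_set M A \<and> set_measurable_wrt (past_algebra M \<F>) A \<and>
        phi_invariant M \<theta> \<phi> A"
    interpret invariant_random_set M \<theta> \<phi> \<F> A
      using A by (intro invariant_set) (auto simp: random_compact_set_def)
    have "AE \<omega> in M. bounded (A \<omega>)"
      using A by (auto simp: random_compact_set_def elim!: eventually_mono intro: compact_imp_bounded)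
    then show "small_diameter M A"
      by (rule contracting_imp_small_diameter[OF assms(2) contr])
  next
    fix U :: "'e set" and A :: "'w \<Rightarrow> 'e set"
    assume U: "open U \<and> U \<noteq> {} \<and> asymptotically_stable_on M \<phi> U"
      and A: "random_closed_set M A \<and> set_measurable_wrt (past_algebra M \<F>) A \<and>
        phi_invariant M \<theta> \<phi> A \<and> small_diameter M A"
    interpret invariant_random_set M \<theta> \<phi> \<F> A
      using A by (intro invariant_set) (auto simp: random_closed_set_def)
    show "AE \<omega> in M. is_singleton (A \<omega>)"
      using stable_imp_singleton[OF assms(2)] A U by blast
  next
    fix U :: "'e set"
    assume U: "open U \<and> U \<noteq> {} \<and> asymptotically_stable_on M \<phi> U"
      and "\<exists>A. weak_attractor M \<theta> \<phi> A \<and> small_diameter M A"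
    then obtain A where A: "weak_attractor M \<theta> \<phi> A" "small_diameter M A" by blast
    interpret invariant_random_set M \<theta> \<phi> \<F> A
    proof unfold_locales
      show "A \<omega> \<noteq> {}" if "\<omega> \<in> space M" for \<omega>
        using weak_attractor_random_compact[OF A(1)] that by (simp add: random_compact_set_def)
    qed (rule weak_attractor_past[OF A(1)] weak_attractor_invariant[OF A(1)])+
    have "AE \<omega> in M. is_singleton (A \<omega>)"
      using stable_imp_singleton[OF assms(2) A(2)] U by blast
    then show "synchronization M \<theta> \<phi>"
      using A(1) by (auto simp: synchronization_def)
  qed
qed

end
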